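(* Let $(W,W')$ be a random vector such that the Mandelbrot cascades $m$ and $m'$ associated to the weights $W$ and $W'$ are non-degenerate. Let $Y_\infty=m([0,1])$ and $Y'_\infty=m'([0,1])$. Suppose that: (i) there exists $r>1$ such that $E[Y_\infty^r]<+\infty$ and $E[(Y'_\infty)^r]<+\infty$; (ii) there exists $\alpha>0$ such that $E[Y_\infty^{-\alpha}]<+\infty$. Then, almost surely, $$\lim_{n\to+\infty}\frac{\log m(I_n(x))}{\log|I_n(x)|}=1-E[W'\log_\ell W]\quad\text{for } m'\text{-almost every }x.$$
   Context: Let $\ell\ge 2$ be an integer. For $n\ge 1$ let $\mathcal{M}_n$ be the set of words $\varepsilon=\varepsilon_1\cdots\varepsilon_n$ of length $n$ with letters in $\{0,\dots,\ell-1\}$, let $\mathcal{M}=\bigcup_{n\ge 1}\mathcal{M}_n$, and let $I_{\varepsilon_1\cdots\varepsilon_n}=\left[\sum_{k=1}^n\frac{\varepsilon_k}{\ell^k},\ \sum_{k=1}^n\frac{\varepsilon_k}{\ell^k}+\frac1{\ell^n}\right)$. $W$ and $W'$ are non-negative random variables with $E[W]=E[W']=1$, defined on the same probability space (not assumed independent of each other), and $(W_\varepsilon,W'_\varepsilon)_{\varepsilon\in\mathcal{M}}$ is a family of independent copies of the vector $(W,W')$. Let $\lambda$ be the Lebesgue measure on $[0,1]$ and $m_n=f_n\lambda$ with $f_n=\sum_{\varepsilon_1\cdots\varepsilon_n\in\mathcal{M}_n}W_{\varepsilon_1}W_{\varepsilon_1\varepsilon_2}\cdots W_{\varepsilon_1\cdots\varepsilon_n}\mathbf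 1_{I_{\varepsilon_1\cdots\varepsilon_n}}$. Almost surely $(m_n)$ converges weakly (against continuous functions on $[0,1]$) to a finite random Borel measure $m$ on $[0,1]$, called the Mandelbrot cascade associated to the weight $W$; $m'$ is defined in the same way from $(W'_\varepsilon)$. A cascade $m$ is non-degenerate if $E[m([0,1])]>0$ (i.e. $P[m([0,1])\neq0]>0$). For $x\in[0,1)$, $I_n(x)$ is the interval $I_\varepsilon$, $\varepsilon\in\mathcal{M}_n$, containing $x$, and $|I|$ is the length of $I$. *)

theory Defs
  imports "HOL-Probability.Probability"
begin

definition words :: "nat \<Rightarrow> nat \<Rightarrow> nat list set" where
  "words l n = {w. length w = n \<and> set w \<subseteq> {..<l}}"

definition nonempty_words :: "nat \<Rightarrow> nat list set" where
  "nonempty_words l = (\<Union>n\<in>{1..}. words l n)"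

text \<open>Lists are indexed from 0, hence the letter \<open>w ! k\<close> has weight \<open>1 / l ^ (k + 1)\<close>.\<close>

definition left_end :: "nat \<Rightarrow> nat list \<Rightarrow> real" where
  "left_end l w = (\<Sum>k<length w. real (w ! k) / real l ^ Suc k)"

definition word_interval :: "nat \<Rightarrow> nat list \<Rightarrow> real set" where
  "word_interval l w = {left_end l w ..< left_end l w + 1 / real l ^ length w}"

text \<open>The interval of generation \<open>n\<close> around \<open>x\<close>; only meaningful for \<open>0 \<le> x < 1\<close>.\<close>

definition cell :: "nat \<Rightarrow> nat \<Rightarrow> real \<Rightarrow> real set" where
  "cell l n x = (THE J. x \<in> J \<and> (\<exists>w\<in>words l n. J = word_interval l w))"

definition independent_copies ::
    "'a measure \<Rightarrow> 'i set \<Rightarrow> ('i \<Rightarrow> 'a \<Rightarrow> 'c::topological_space) \<Rightarrow> 'b measure \<Rightarrow> ('b \<Rightarrow> 'c) \<Rightarrow> bool" where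
  "independent_copies M J X N X0 \<longleftrightarrow>
     prob_space.indep_vars M (\<lambda>_. borel) X J \<and>
     (\<forall>j\<in>J. distr M borel (X j) = distr N borel X0)"

definition cascade_density :: "nat \<Rightarrow> (nat list \<Rightarrow> 'a \<Rightarrow> real) \<Rightarrow> nat \<Rightarrow> 'a \<Rightarrow> real \<Rightarrow> real" where
  "cascade_density l V n \<omega> x =
     (\<Sum>w\<in>words l n. (\<Prod>k=1..n. V (take k w) \<omega>) * indicator (word_interval l w) x)"

definition cascade_approx :: "nat \<Rightarrow> (nat list \<Rightarrow> 'a \<Rightarrow> real) \<Rightarrow> nat \<Rightarrow> 'a \<Rightarrow> real measure" where
  "cascade_approx l V n \<omega> =
     density (restrict_space lborel {0..1}) (\<lambda>x. ennreal (cascade_density l V n \<omega> x))"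

definition finite_random_measure :: "'a measure \<Rightarrow> ('a \<Rightarrow> real measure) \<Rightarrow> bool" where
  "finite_random_measure M m \<longleftrightarrow>
     (\<forall>\<omega>\<in>space M. sets (m \<omega>) = sets (restrict_space borel {0..1}) \<and> finite_measure (m \<omega>)) \<and>
     (\<forall>A\<in>sets (restrict_space borel {0..1}). (\<lambda>\<omega>. emeasure (m \<omega>) A) \<in> borel_measurable M)"

text \<open>
  The limit measure is determined by the weights only up to a null set, so it is described by a
  predicate satisfied by all of its versions.
\<close>

definition mandelbrot_cascade ::
    "nat \<Rightarrow> 'a measure \<Rightarrow> (nat list \<Rightarrow> 'a \<Rightarrow> real) \<Rightarrow> ('a \<Rightarrow> real measure) \<Rightarrow> bool" where
  "mandelbrot_cascade l M V m \<longleftrightarrow>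
     finite_random_measure M m \<and>
     (AE \<omega> in M. \<forall>f::real \<Rightarrow> real. continuous_on {0..1} f \<longrightarrow>
        (\<lambda>n. \<integral>x. f x \<partial>(cascade_approx l V n \<omega>)) \<longlonglongrightarrow> (\<integral>x. f x \<partial>(m \<omega>)))"

definition total_mass :: "('a \<Rightarrow> real measure) \<Rightarrow> 'a \<Rightarrow> real" where
  "total_mass m \<omega> = measure (m \<omega>) {0..1}"

definition nondegenerate :: "'a measure \<Rightarrow> ('a \<Rightarrow> real measure) \<Rightarrow> bool" where
  "nondegenerate M m \<longleftrightarrow> (\<integral>\<^sup>+\<omega>. emeasure (m \<omega>) {0..1} \<partial>M) > 0"

end

theory Submission imports Defs begin

text \<open>
  For a word \<open>w\<close> of length \<open>n\<close> let \<open>Q(w)\<close>, \<open>Q'(w)\<close> be the products of the weights on the path to \<open>w\<close>, and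
  \<open>Y(w)\<close>, \<open>Y'(w)\<close> the total masses of the cascades built on the tree below \<open>w\<close>. Almost surely
  \<open>m(I\<^sub>w) = l\<^sup>-\<^sup>n Q(w) Y(w)\<close>, and likewise for \<open>m'\<close>. With \<open>Z(w) = Q(w) Y(w)\<close> the quotient in the theorem
  is \<open>1 - ln Z(w) / (n ln l)\<close> for the cell \<open>I\<^sub>w\<close> of generation \<open>n\<close> around \<open>x\<close>. So the claim is
  \<open>ln Z(w) / n \<longrightarrow> \<mu>\<close> with \<open>\<mu> = E[W' ln W]\<close>, at \<open>m'\<close>-almost every \<open>x\<close>.

  This follows from Chernoff's bound. The weights on the path are independent of each other and of
  the tree below \<open>w\<close>, hence (\<open>nn_integral_cell_moment\<close>)
  \<open>E[\<Sum>\<^sub>w m'(I\<^sub>w) Z(w)\<^sup>s] = E[W' W\<^sup>s]\<^sup>n E[Y' Y\<^sup>s]\<close>, the sum being over all words of length \<open>n\<close>. As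
  \<open>E[W' W\<^sup>s] = 1 + s \<mu> + O(s\<^sup>2)\<close> (\<open>exponential_moment_bound\<close>), small \<open>s\<close> of either sign show that the
  expected \<open>m'\<close>-mass of the cells with \<open>\<bar>ln Z(w) - n \<mu>\<bar> \<ge> n \<delta>\<close> decays geometrically in \<open>n\<close>. The
  Borel--Cantelli lemma, applied to almost every realisation of \<open>m'\<close>, does the rest
  (\<open>AE_AE_eventually_powr_less\<close>).

  The argument needs \<open>E[W' W\<^sup>s]\<close> and \<open>E[Y' Y\<^sup>s]\<close> to be finite for small \<open>s\<close> of either sign. By Young's
  inequality (\<open>product_moments_finite\<close>) it is enough that \<open>W\<close>, \<open>W'\<close>, \<open>Y\<close>, \<open>Y'\<close> have a moment of some order
  \<open>r > 1\<close> and that \<open>W\<close>, \<open>Y\<close> have some negative moment. The recursive equation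
  \<open>Y = (\<Sum>\<^sub>j V\<^sub>j Y\<^sub>j) / l\<close> transfers both from the total masses to the weights: the positive moments
  because \<open>Y \<ge> V\<^sub>0 Y\<^sub>0 / l\<close> (\<open>weight_moment_finite\<close>), the negative ones because \<open>Y\<close> is small when all \<open>V\<^sub>j\<close>
  are small and all \<open>Y\<^sub>j\<close> are bounded (\<open>weight_small_ball\<close>). In particular \<open>W > 0\<close> almost surely.

  The formula for \<open>m(I\<^sub>w)\<close> requires that weak convergence implies convergence on cells, that is, that
  the end points of the cells are not atoms. This holds because the expectation of \<open>m\<close> is dominated by
  Lebesgue measure (\<open>AE_no_atom\<close>).
\<close>

section \<open>Words and their cells\<close>

lemma words_0 [simp]: "words l 0 = {[]}"
  by (auto simp: words_def)

lemma words_Suc: "words l (Suc n) = (\<lambda>(j, v). j # v) ` ({..<l} \<times> words l n)"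
  by (auto simp: words_def length_Suc_conv image_iff)

lemma finite_words [simp, intro]: "finite (words l n)"
  by (induction n) (auto simp: words_Suc)

lemma card_words: "card (words l n) = l ^ n"
proof (induction n)
  case (Suc n)
  have "inj_on (\<lambda>(j, v). j # v) ({..<l} \<times> words l n)"
    by (auto simp: inj_on_def)
  then show ?case
    using Suc by (simp add: words_Suc card_image card_cartesian_product)
qed simp

lemma length_words: "w \<in> words l n \<Longrightarrow> length w = n"
  by (simp add: words_def)

lemma words_extending:
  assumes "w \<in> words l n"
  shows "{u \<in> words l (n + k). take n u = w} = (@) w ` words l k"
proof safe
  fix u assume u: "u \<in> words l (n + k)" "w = take n u"
  have "drop n u \<in> words l k"
    using u(1) by (auto simp: words_def dest: in_set_dropD)
  then show "u \<in> (@) (take n u) ` words l k"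
    by (metis append_take_drop_id imageI)
qed (use assms in \<open>auto simp: words_def\<close>)

lemma nonempty_words_iff: "w \<in> nonempty_words l \<longleftrightarrow> w \<noteq> [] \<and> set w \<subseteq> {..<l}"
  by (auto simp: nonempty_words_def words_def Suc_le_eq)

lemma take_nonempty_word:
  "w \<in> words l n \<Longrightarrow> k \<in> {1..n} \<Longrightarrow> take k w \<in> nonempty_words l"
  by (auto simp: nonempty_words_iff words_def dest: in_set_takeD)

lemma countable_nonempty_words: "countable (nonempty_words l)"
  by (auto simp: nonempty_words_def intro!: countable_UN countable_finite)

lemma append_nonempty_words:
  "w \<in> words l n \<Longrightarrow> v \<in> nonempty_words l \<Longrightarrow> w @ v \<in> nonempty_words l"
  by (auto simp: nonempty_words_iff words_def)

lemma left_end_Nil [simp]: "left_end l [] = 0"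
  by (simp add: left_end_def)

lemma left_end_Cons: "left_end l (j # v) = (real j + left_end l v) / real l"
  by (simp add: left_end_def sum.lessThan_Suc_shift add_divide_distrib sum_divide_distrib mult.commute
      del: sum.lessThan_Suc)

lemma left_end_append: "left_end l (w @ v) = left_end l w + left_end l v / real l ^ length w"
  by (induction w) (simp_all add: left_end_Cons add_divide_distrib mult.commute)

lemma left_end_bounds:
  assumes l: "l \<ge> 1" and "w \<in> words l n"
  shows "0 \<le> left_end l w" "left_end l w + 1 / real l ^ n \<le> 1"
  using assms(2)
proof (induction n arbitrary: w)
  case (Suc n)
  {
    case 1
    then obtain j v where w: "w = j # v" "j < l" "v \<in> words l n"
      by (auto simp: words_Suc)
    show ?case
      using Suc(1)[OF w(3)] by (simp add: w(1) left_end_Cons)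
  next
    case 2
    then obtain j v where w: "w = j # v" "j < l" "v \<in> words l n"
      by (auto simp: words_Suc)
    have "(real j + (left_end l v + 1 / real l ^ n)) / real l \<le> 1"
      using Suc(2)[OF w(3)] w(2) by (intro divide_le_eq_1_pos[THEN iffD2]) linarith+
    then show ?case
      by (simp add: w(1) left_end_Cons add_divide_distrib mult.commute)
  }
qed (auto simp: words_def)

lemma word_interval_Cons:
  assumes l: "l \<ge> 1"
  shows "x \<in> word_interval l (j # v) \<longleftrightarrow> real l * x - real j \<in> word_interval l v"
proof -
  have "left_end l (j # v) \<le> x \<longleftrightarrow> left_end l v \<le> real l * x - real j"
    using l by (auto simp: left_end_Cons divide_le_eq algebra_simps)
  moreover have "x < left_end l (j # v) + 1 / real l ^ length (j # v) \<longleftrightarrow>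
      x < (real j + left_end l v + 1 / real l ^ length v) / real l"
    by (simp add: left_end_Cons add_divide_distrib mult.commute)
  moreover have "\<dots> \<longleftrightarrow> real l * x - real j < left_end l v + 1 / real l ^ length v"
    using l by (auto simp: less_divide_eq algebra_simps)
  ultimately show ?thesis
    by (simp add: word_interval_def)
qed

lemma word_interval_subset:
  assumes l: "l \<ge> 1" and "w \<in> words l n"
  shows "word_interval l w \<subseteq> {0..<1}"
  using left_end_bounds[OF assms] length_words[OF assms(2)] by (auto simp: word_interval_def)

lemma word_interval_append_subset:
  assumes l: "l \<ge> 1" and v: "v \<in> words l k"
  shows "word_interval l (w @ v) \<subseteq> word_interval l w"
proof -
  have b: "0 \<le> left_end l v / real l ^ length w"
    "(left_end l v + 1 / real l ^ k) / real l ^ length w \<le> 1 / real l ^ length w"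
    using left_end_bounds[OF l v] l by (auto intro!: divide_right_mono)
  then show ?thesis
    using length_words[OF v]
    by (auto simp: word_interval_def left_end_append power_add add_divide_distrib mult.commute)
qed

text \<open>
  The first letter of the word whose cell contains \<open>x\<close> has to be \<open>\<lfloor>l x\<rfloor>\<close>, and its tail is
  determined by the position of \<open>x\<close> after rescaling.
\<close>

lemma ex1_word_interval:
  assumes l: "l \<ge> 1" and x: "0 \<le> x" "x < 1"
  shows "\<exists>!w. w \<in> words l n \<and> x \<in> word_interval l w"
  using x
proof (induction n arbitrary: x)
  case 0
  then show ?case by (auto simp: word_interval_def)
next
  case (Suc n)
  define j where "j = nat \<lfloor>real l * x\<rfloor>"
  have lx: "0 \<le> real l * x" "real l * x < real l"
    using l Suc.prems by (auto simp: mult_less_cancel_left1)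
  have j: "j < l" "0 \<le> real l * x - real j" "real l * x - real j < 1"
    using lx unfolding j_def by linarith+
  obtain v where v: "v \<in> words l n" "real l * x - real j \<in> word_interval l v"
    and uniq: "\<And>v'. v' \<in> words l n \<Longrightarrow> real l * x - real j \<in> word_interval l v' \<Longrightarrow> v' = v"
    using Suc.IH[OF j(2,3)] by blast
  show ?case
  proof (rule ex1I[of _ "j # v"])
    show "j # v \<in> words l (Suc n) \<and> x \<in> word_interval l (j # v)"
      using j v by (auto simp: words_Suc word_interval_Cons[OF l])
  next
    fix w assume w: "w \<in> words l (Suc n) \<and> x \<in> word_interval l w"
    then obtain i u where iu: "w = i # u" "u \<in> words l n" "real l * x - real i \<in> word_interval l u"
      by (auto simp: words_Suc word_interval_Cons[OF l])
    then have "real l * x - real i \<in> {0..<1}"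
      using word_interval_subset[OF l iu(2)] by blast
    then have "i = j"
      unfolding j_def by (simp, linarith)
    then show "w = j # v"
      using iu uniq by simp
  qed
qed

lemma word_intervals_disjoint:
  assumes l: "l \<ge> 1" and "u \<in> words l n" "w \<in> words l n" "u \<noteq> w"
  shows "word_interval l u \<inter> word_interval l w = {}"
proof (rule ccontr)
  assume "word_interval l u \<inter> word_interval l w \<noteq> {}"
  then obtain x where x: "x \<in> word_interval l u" "x \<in> word_interval l w"
    by blast
  then have "0 \<le> x" "x < 1"
    using word_interval_subset[OF l assms(2)] by auto
  then show False
    using ex1_word_interval[OF l, of x n] x assms by blast
qed

lemma UN_word_interval:
  assumes l: "l \<ge> 1"
  shows "(\<Union>w\<in>words l n. word_interval l w) = {0..<1}"
proof
  show "(\<Union>w\<in>words l n. word_interval l w) \<subseteq> {0..<1}"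
    using word_interval_subset[OF l] by blast
  show "{0..<1} \<subseteq> (\<Union>w\<in>words l n. word_interval l w)"
  proof
    fix x :: real assume "x \<in> {0..<1}"
    then show "x \<in> (\<Union>w\<in>words l n. word_interval l w)"
      using ex1_word_interval[OF l, of x n] by auto
  qed
qed

lemma cell_eq:
  assumes l: "l \<ge> 1" and "w \<in> words l n" "x \<in> word_interval l w"
  shows "cell l n x = word_interval l w"
  unfolding cell_def
proof (rule the_equality)
  show "x \<in> word_interval l w \<and> (\<exists>v\<in>words l n. word_interval l w = word_interval l v)"
    using assms by auto
next
  fix J assume "x \<in> J \<and> (\<exists>v\<in>words l n. J = word_interval l v)"
  then obtain v where v: "v \<in> words l n" "J = word_interval l v" "x \<in> word_interval l v"
    by auto
  then have "v = w"
    using word_intervals_disjoint[OF l v(1) assms(2)] assms(3) by auto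
  then show "J = word_interval l w"
    using v by simp
qed

lemma word_interval_sets [measurable]: "word_interval l w \<in> sets borel"
  by (simp add: word_interval_def)

lemma emeasure_word_interval: 
  "emeasure lborel (word_interval l w) = ennreal (1 / real l ^ length w)"
  by (simp add: word_interval_def emeasure_lborel_Ico)

lemma measure_word_interval: 
  "measure lborel (word_interval l w) = 1 / real l ^ length w"
  by (simp add: measure_def emeasure_word_interval)

lemma word_interval_Int:
  assumes l: "l \<ge> 1" and w: "w \<in> words l n" and u: "u \<in> words l (n + k)"
  shows "word_interval l u \<inter> word_interval l w = (if take n u = w then word_interval l u else {})"
proof -
  have tu: "take n u \<in> words l n" "drop n u \<in> words l k"
    using u by (auto simp: words_def dest: in_set_takeD in_set_dropD)
  then have "word_interval l u \<subseteq> word_interval l (take n u)"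
    using word_interval_append_subset[OF l tu(2), of "take n u"] by simp
  then show ?thesis
    using word_intervals_disjoint[OF l tu(1) w] by auto
qed

section \<open>Masses of the approximating densities\<close>

definition path_weight :: "(nat list \<Rightarrow> real) \<Rightarrow> nat list \<Rightarrow> real" where
  "path_weight F w = (\<Prod>k=1..length w. F (take k w))"

text \<open>
  For weights \<open>F\<close>, this is the total mass of the \<open>k\<close>-th approximating measure. It is a function of the
  weights alone, so it applies as well to the weights seen from a node \<open>w\<close>, namely \<open>\<lambda>v. F (w @ v)\<close>.
\<close>

definition level_mass :: "nat \<Rightarrow> (nat list \<Rightarrow> real) \<Rightarrow> nat \<Rightarrow> real" where
  "level_mass l F k = (\<Sum>v\<in>words l k. path_weight F v) / real l ^ k"

text \<open>
  Taking the lower limit in \<open>ennreal\<close> makes the limit mass a measurable function of all weights,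
  without a choice on the event that the masses fail to converge.
\<close>

definition limit_mass :: "nat \<Rightarrow> (nat list \<Rightarrow> real) \<Rightarrow> ennreal" where
  "limit_mass l F = liminf (\<lambda>k. ennreal (level_mass l F k))"

lemma path_weight_Nil [simp]: "path_weight F [] = 1"
  by (simp add: path_weight_def)

lemma path_weight_append:
  "path_weight F (w @ v) = path_weight F w * path_weight (\<lambda>u. F (w @ u)) v"
proof -
  have "path_weight F (w @ v) = (\<Prod>k\<in>{1..length w} \<union> {length w + 1..length w + length v}. F (take k (w @ v)))"
    unfolding path_weight_def by (intro prod.cong) auto
  also have "\<dots> = (\<Prod>k=1..length w. F (take k (w @ v))) *
      (\<Prod>k=length w + 1..length w + length v. F (take k (w @ v)))"
    by (intro prod.union_disjoint) auto
  also have "(\<Prod>k=1..length w. F (take k (w @ v))) = path_weight F w"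
    unfolding path_weight_def by (intro prod.cong) auto
  also have "(\<Prod>k=length w + 1..length w + length v. F (take k (w @ v))) =
      path_weight (\<lambda>u. F (w @ u)) v"
    unfolding path_weight_def
    by (intro prod.reindex_bij_witness[of _ "\<lambda>k. k + length w" "\<lambda>k. k - length w"]) auto
  finally show ?thesis .
qed

lemma path_weight_nonneg:
  assumes "\<And>v. v \<in> nonempty_words l \<Longrightarrow> 0 \<le> F v" "w \<in> words l n"
  shows "0 \<le> path_weight F w"
  unfolding path_weight_def
  using assms take_nonempty_word[OF assms(2)] length_words[OF assms(2)] by (intro prod_nonneg) auto

lemma path_weight_cong:
  assumes "\<And>v. v \<in> nonempty_words l \<Longrightarrow> F v = G v" "w \<in> words l n"
  shows "path_weight F w = path_weight G w"
  unfolding path_weight_def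
  using assms take_nonempty_word[OF assms(2)] length_words[OF assms(2)] by (intro prod.cong) auto

lemma limit_mass_cong:
  assumes "\<And>v. v \<in> nonempty_words l \<Longrightarrow> F v = G v"
  shows "limit_mass l F = limit_mass l G"
  unfolding limit_mass_def level_mass_def
  by (intro arg_cong[of _ _ liminf] ext arg_cong[of _ _ ennreal] arg_cong2[of _ _ _ _ "(/)"]
      sum.cong path_weight_cong[OF assms]) auto

lemma cascade_density_eq:
  "cascade_density l V n \<omega> x =
    (\<Sum>w\<in>words l n. path_weight (\<lambda>v. V v \<omega>) w * indicator (word_interval l w) x)"
  unfolding cascade_density_def path_weight_def by (intro sum.cong) (auto simp: length_words)

lemma nn_integral_cascade_approx:
  assumes l: "l \<ge> 1" and nonneg: "\<And>v. v \<in> nonempty_words l \<Longrightarrow> 0 \<le> V v \<omega>"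
    and g [measurable]: "g \<in> borel_measurable borel"
  shows "(\<integral>\<^sup>+x. g x \<partial>cascade_approx l V n \<omega>) =
    (\<Sum>w\<in>words l n. ennreal (path_weight (\<lambda>v. V v \<omega>) w) *
       (\<integral>\<^sup>+x. indicator (word_interval l w) x * g x \<partial>lborel))"
proof -
  let ?Q = "path_weight (\<lambda>v. V v \<omega>)"
  have [measurable]: "g \<in> borel_measurable (restrict_space lborel {0..1})"
    "cascade_density l V n \<omega> \<in> borel_measurable borel"
    by (auto simp: cascade_density_eq[abs_def] simp del: sum_mult_indicator intro!: measurable_restrict_space1)
  then have [measurable]: "cascade_density l V n \<omega> \<in> borel_measurable (restrict_space lborel {0..1})"
    by (intro measurable_restrict_space1) auto
  have "(\<integral>\<^sup>+x. g x \<partial>cascade_approx l V n \<omega>) =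
     (\<integral>\<^sup>+x. ennreal (cascade_density l V n \<omega> x) * g x * indicator {0..1} x \<partial>lborel)"
    by (simp add: cascade_approx_def nn_integral_density nn_integral_restrict_space)
  also have "\<dots> = (\<integral>\<^sup>+x. (\<Sum>w\<in>words l n. ennreal (?Q w) * (indicator (word_interval l w) x * g x)) \<partial>lborel)"
  proof (intro nn_integral_cong)
    fix x :: real
    have "ennreal (cascade_density l V n \<omega> x) =
        (\<Sum>w\<in>words l n. ennreal (?Q w) * indicator (word_interval l w) x)"
      unfolding cascade_density_eq
      by (subst sum_ennreal[symmetric])
         (auto simp: path_weight_nonneg[OF nonneg] ennreal_mult ennreal_indicator intro!: sum.cong mult_nonneg_nonneg)
    then have "ennreal (cascade_density l V n \<omega> x) * g x * indicator {0..1} x =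
       (\<Sum>w\<in>words l n. ennreal (?Q w) * indicator (word_interval l w) x * g x * indicator {0..1} x)"
      by (simp only: sum_distrib_right)
    also have "\<dots> = (\<Sum>w\<in>words l n. ennreal (?Q w) * (indicator (word_interval l w) x * g x))"
      using word_interval_subset[OF l] by (intro sum.cong) (fastforce simp: indicator_def)+
    finally show "ennreal (cascade_density l V n \<omega> x) * g x * indicator {0..1} x =
       (\<Sum>w\<in>words l n. ennreal (?Q w) * (indicator (word_interval l w) x * g x))" .
  qed
  also have "\<dots> = (\<Sum>w\<in>words l n. ennreal (?Q w) *
       (\<integral>\<^sup>+x. indicator (word_interval l w) x * g x \<partial>lborel))"
    by (subst nn_integral_sum) (auto simp: nn_integral_cmult intro!: sum.cong)
  finally show ?thesis .
qed

lemma sets_cascade_approx [measurable_cong]: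
  "sets (cascade_approx l V n \<omega>) = sets (restrict_space borel {0..1})"
  by (simp add: cascade_approx_def sets_restrict_space)

text \<open>
  The density at generation \<open>n + k\<close> is constant on cells of that generation, and the cells inside
  \<open>word_interval l w\<close> belong to the words \<open>w @ v\<close>; their path weights split at \<open>w\<close>.
\<close>

lemma emeasure_cascade_approx_word_interval:
  assumes l: "l \<ge> 1" and nonneg: "\<And>v. v \<in> nonempty_words l \<Longrightarrow> 0 \<le> V v \<omega>"
    and w: "w \<in> words l n"
  shows "emeasure (cascade_approx l V (n + k) \<omega>) (word_interval l w) =
    ennreal (path_weight (\<lambda>v. V v \<omega>) w / real l ^ n) * ennreal (level_mass l (\<lambda>v. V (w @ v) \<omega>) k)"
proof -
  let ?Q = "path_weight (\<lambda>v. V v \<omega>)" and ?R = "path_weight (\<lambda>v. V (w @ v) \<omega>)"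
  have S: "word_interval l w \<in> sets (cascade_approx l V (n + k) \<omega>)"
    using word_interval_subset[OF l w] word_interval_sets[of l w]
    by (auto simp: sets_cascade_approx sets_restrict_space image_iff
        intro!: bexI[of _ "word_interval l w"])
  have nonneg': "0 \<le> ?R v" if "v \<in> words l k" for v
    by (rule path_weight_nonneg[OF _ that]) (auto intro!: nonneg append_nonempty_words w)
  have "emeasure (cascade_approx l V (n + k) \<omega>) (word_interval l w) =
      (\<integral>\<^sup>+x. indicator (word_interval l w) x \<partial>cascade_approx l V (n + k) \<omega>)"
    using S by simp
  also have "\<dots> = (\<Sum>u\<in>words l (n + k). ennreal (?Q u) *
       (\<integral>\<^sup>+x. indicator (word_interval l u) x * indicator (word_interval l w) x \<partial>lborel))"
    using nonneg by (intro nn_integral_cascade_approx[OF l]) auto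
  also have "\<dots> = (\<Sum>u\<in>words l (n + k). if take n u = w then ennreal (?Q u * (1 / real l ^ (n + k))) else 0)"
  proof (intro sum.cong refl)
    fix u assume u: "u \<in> words l (n + k)"
    have "(\<integral>\<^sup>+x. indicator (word_interval l u) x * indicator (word_interval l w) x \<partial>lborel) =
        emeasure lborel (word_interval l u \<inter> word_interval l w)"
      by (simp add: indicator_inter_arith[symmetric])
    also have "\<dots> = (if take n u = w then ennreal (1 / real l ^ (n + k)) else 0)"
      using u by (simp add: word_interval_Int[OF l w u] emeasure_word_interval length_words)
    finally show "ennreal (?Q u) *
       (\<integral>\<^sup>+x. indicator (word_interval l u) x * indicator (word_interval l w) x \<partial>lborel) =
       (if take n u = w then ennreal (?Q u * (1 / real l ^ (n + k))) else 0)"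
      using path_weight_nonneg[OF nonneg u] by (auto simp: ennreal_mult'[symmetric])
  qed
  also have "\<dots> = (\<Sum>u\<in>(@) w ` words l k. ennreal (?Q u * (1 / real l ^ (n + k))))"
    unfolding words_extending[OF w, symmetric] by (rule sum.inter_filter[symmetric]) simp
  also have "\<dots> = (\<Sum>v\<in>words l k. ennreal (?Q w / real l ^ n) * ennreal (?R v / real l ^ k))"
    using nonneg' path_weight_nonneg[OF nonneg w]
    by (subst sum.reindex)
       (auto simp: inj_on_def path_weight_append ennreal_mult[symmetric] power_add intro!: sum.cong)
  also have "\<dots> = ennreal (?Q w / real l ^ n) * ennreal (level_mass l (\<lambda>v. V (w @ v) \<omega>) k)"
    unfolding level_mass_def sum_divide_distrib sum_distrib_left[symmetric]
    using nonneg' by (subst sum_ennreal) auto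
  finally show ?thesis .
qed

section \<open>Independence of disjoint pieces of the tree\<close>

lemma limit_mass_measurable:
  assumes h: "h \<in> borel_measurable borel"
  shows "(\<lambda>f. limit_mass l (\<lambda>v. h (f v))) \<in> borel_measurable (Pi\<^sub>M (nonempty_words l) (\<lambda>_. borel))"
proof -
  have "(\<lambda>f. h (f v)) \<in> borel_measurable (Pi\<^sub>M (nonempty_words l) (\<lambda>_. borel))"
    if "v \<in> nonempty_words l" for v
    using h that by measurable
  then have "(\<lambda>f. \<Sum>w\<in>words l k. \<Prod>j=1..k. h (f (take j w)))
      \<in> borel_measurable (Pi\<^sub>M (nonempty_words l) (\<lambda>_. borel))" for k
    by (intro borel_measurable_sum borel_measurable_prod) (use take_nonempty_word in blast)
  moreover have "level_mass l F k = (\<Sum>w\<in>words l k. \<Prod>j=1..k. F (take j w)) / real l ^ k" for F k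
    unfolding level_mass_def path_weight_def by (simp add: length_words)
  ultimately show ?thesis
    unfolding limit_mass_def by simp
qed

text \<open>
  The weights may take values in any space: the same facts are applied to a single family of real
  weights and to the family of pairs, whose components depend on each other.
\<close>

locale branching_weights = prob_space M for M :: "'a measure" +
  fixes l :: nat and X :: "nat list \<Rightarrow> 'a \<Rightarrow> 'c::topological_space" and D :: "'c measure"
  assumes l_ge_2: "l \<ge> 2"
    and indep: "indep_vars (\<lambda>_. borel) X (nonempty_words l)"
    and law: "\<And>w. w \<in> nonempty_words l \<Longrightarrow> distr M borel (X w) = D"
begin

abbreviation trees :: "(nat list \<Rightarrow> 'c) measure" where
  "trees \<equiv> Pi\<^sub>M (nonempty_words l) (\<lambda>_. borel)"

definition subtree :: "nat list \<Rightarrow> 'a \<Rightarrow> nat list \<Rightarrow> 'c" where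
  "subtree w \<omega> = (\<lambda>v\<in>nonempty_words l. X (w @ v) \<omega>)"

lemma l_ge_1: "l \<ge> 1"
  using l_ge_2 by simp

lemma X_measurable: "w \<in> nonempty_words l \<Longrightarrow> X w \<in> borel_measurable M"
  using indep by (auto simp: indep_vars_def)

lemma nonempty_words_not_empty: "nonempty_words l \<noteq> {}"
proof -
  have "[0] \<in> nonempty_words l"
    using l_ge_2 by (auto simp: nonempty_words_iff)
  then show ?thesis by blast
qed

lemma subtree_measurable: "w \<in> words l n \<Longrightarrow> subtree w \<in> measurable M trees"
  unfolding subtree_def by (intro measurable_restrict X_measurable append_nonempty_words)

lemma AE_law:
  assumes "AE x in D. P x" "w \<in> nonempty_words l" 
  shows "AE \<omega> in M. P (X w \<omega>)"
  using assms(1) unfolding law[OF assms(2), symmetric]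
  by (rule AE_distrD[OF X_measurable[OF assms(2)]])

lemma nn_integral_law:
  assumes "g \<in> borel_measurable borel" "w \<in> nonempty_words l" 
  shows "(\<integral>\<^sup>+\<omega>. g (X w \<omega>) \<partial>M) = (\<integral>\<^sup>+x. g x \<partial>D)"
  unfolding law[OF assms(2), symmetric]
  using assms by (subst nn_integral_distr) (auto intro: X_measurable)

lemma distr_subtree:
  assumes w: "w \<in> words l n"
  shows "distr M trees (subtree w) = Pi\<^sub>M (nonempty_words l) (\<lambda>_. D)"
proof -
  let ?I = "nonempty_words l"
  \<comment> \<open>Singleton blocks reindex the independent family along \<open>v \<mapsto> w @ v\<close>.\<close>
  have "indep_vars (\<lambda>v. Pi\<^sub>M {w @ v} (\<lambda>_. borel)) (\<lambda>v \<omega>. restrict (\<lambda>u. X u \<omega>) {w @ v}) ?I"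
    using w by (intro indep_vars_restrict[OF indep]) (auto simp: disjoint_family_on_def intro: append_nonempty_words)
  then have "indep_vars (\<lambda>_. borel) (\<lambda>v \<omega>. restrict (\<lambda>u. X u \<omega>) {w @ v} (w @ v)) ?I"
    by (rule indep_vars_compose2) auto
  then have ind: "indep_vars (\<lambda>_. borel) (\<lambda>v. X (w @ v)) ?I"
    by simp
  have "distr M trees (subtree w) = (\<Pi>\<^sub>M v\<in>?I. distr M borel (X (w @ v)))"
    using indep_vars_iff_distr_eq_PiM'[of ?I "\<lambda>v. X (w @ v)" "\<lambda>_. borel"] ind nonempty_words_not_empty
    unfolding subtree_def by (auto simp: X_measurable append_nonempty_words[OF w])
  also have "\<dots> = Pi\<^sub>M ?I (\<lambda>_. D)"
    by (intro PiM_cong) (auto simp: law append_nonempty_words[OF w])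
  finally show ?thesis .
qed

lemma subtree_Nil_eq_in_law:
  "w \<in> words l n \<Longrightarrow> distr M trees (subtree w) = distr M trees (subtree [])"
  using distr_subtree[of w n] distr_subtree[of "[]" 0] by simp

lemma nn_integral_subtree:
  assumes w: "w \<in> words l n" and G: "G \<in> borel_measurable trees"
  shows "(\<integral>\<^sup>+\<omega>. G (subtree w \<omega>) \<partial>M) = (\<integral>\<^sup>+\<omega>. G (subtree [] \<omega>) \<partial>M)"
  using nn_integral_distr[OF subtree_measurable[OF w], of G]
    nn_integral_distr[OF subtree_measurable[of "[]" 0], of G] subtree_Nil_eq_in_law[OF w] G by simp

lemma AE_subtree:
  assumes w: "w \<in> words l n" and P: "Measurable.pred trees P" and AE: "AE \<omega> in M. P (subtree [] \<omega>)"
  shows "AE \<omega> in M. P (subtree w \<omega>)"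
proof -
  have P': "{f \<in> space trees. P f} \<in> sets trees"
    using P by measurable
  have "AE f in distr M trees (subtree []). P f"
    using AE_distr_iff[OF subtree_measurable[of "[]" 0] P'] AE by simp
  then show ?thesis
    unfolding subtree_Nil_eq_in_law[OF w, symmetric] by (rule AE_distrD[OF subtree_measurable[OF w]])
qed

text \<open>
  The branching property: the weights on the path to \<open>w\<close> are independent of each other and of the
  subtree rooted at \<open>w\<close>, which has the law of the whole tree.
\<close>

lemma nn_integral_path_subtree:
  assumes w: "w \<in> words l n" and g: "g \<in> borel_measurable borel" and G: "G \<in> borel_measurable trees"
  shows "(\<integral>\<^sup>+\<omega>. (\<Prod>k=1..n. g (X (take k w) \<omega>)) * G (subtree w \<omega>) \<partial>M) =
    (\<integral>\<^sup>+x. g x \<partial>D) ^ n * (\<integral>\<^sup>+\<omega>. G (subtree [] \<omega>) \<partial>M)"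
proof -
  let ?I = "nonempty_words l"
  \<comment> \<open>Block \<open>0\<close> is the subtree, block \<open>j > 0\<close> the prefix of length \<open>j\<close>; prefixes have length at most
    \<open>n\<close> and proper descendants of \<open>w\<close> are longer, so the blocks are disjoint.\<close>
  define K where "K j = (if j = 0 then (@) w ` ?I else {take j w})" for j
  define Y :: "nat \<Rightarrow> (nat list \<Rightarrow> 'c) \<Rightarrow> ennreal" where
    "Y j f = (if j = 0 then G (\<lambda>v\<in>?I. f (w @ v)) else g (f (take j w)))" for j f
  have len: "length w = n"
    using w by (rule length_words)
  have K: "K j \<subseteq> ?I" if "j \<in> {0..n}" for j
    using that w take_nonempty_word[OF w, of j] by (auto simp: K_def intro: append_nonempty_words)
  have disj: "disjoint_family_on K {0..n}"
    unfolding disjoint_family_on_def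
  proof safe
    fix i j x assume *: "i \<in> {0..n}" "j \<in> {0..n}" "i \<noteq> j" "x \<in> K i" "x \<in> K j"
    have length_K: "if i = 0 then n < length x else length x = i" if "i \<le> n" "x \<in> K i" for i
      using that by (auto simp: K_def len nonempty_words_iff)
    show "x \<in> {}"
      using length_K[of i] length_K[of j] * by (auto split: if_splits)
  qed
  have "indep_vars (\<lambda>j. Pi\<^sub>M (K j) (\<lambda>_. borel)) (\<lambda>j \<omega>. restrict (\<lambda>u. X u \<omega>) (K j)) {0..n}"
    by (intro indep_vars_restrict[OF indep] K disj)
  moreover have "Y j \<in> measurable (Pi\<^sub>M (K j) (\<lambda>_. borel)) borel" if "j \<in> {0..n}" for j
  proof (cases "j = 0")
    case True
    have "(\<lambda>f. \<lambda>v\<in>?I. f (w @ v)) \<in> measurable (Pi\<^sub>M (K j) (\<lambda>_. borel)) trees"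
      by (intro measurable_restrict measurable_component_singleton) (auto simp: K_def True)
    from measurable_compose[OF this G] show ?thesis
      by (simp add: Y_def[abs_def] True)
  next
    case False
    then have "(\<lambda>f. f (take j w)) \<in> measurable (Pi\<^sub>M (K j) (\<lambda>_. borel)) borel"
      by (intro measurable_component_singleton) (auto simp: K_def)
    from measurable_compose[OF this g] show ?thesis
      by (simp add: Y_def[abs_def] False)
  qed
  ultimately have ind: "indep_vars (\<lambda>_. borel) (\<lambda>j \<omega>. Y j (restrict (\<lambda>u. X u \<omega>) (K j))) {0..n}"
    by (rule indep_vars_compose2)
  have Y0: "Y 0 (restrict (\<lambda>u. X u \<omega>) (K 0)) = G (subtree w \<omega>)" for \<omega>
    unfolding Y_def K_def subtree_def by (auto intro!: arg_cong[of _ _ G])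
  have Yj: "Y j (restrict (\<lambda>u. X u \<omega>) (K j)) = g (X (take j w) \<omega>)" if "j \<in> {1..n}" for j \<omega>
    using that by (simp add: Y_def K_def)
  have split: "(\<Prod>j\<in>{0..n}. h j) = (\<Prod>j=1..n. h j) * h 0" for h :: "nat \<Rightarrow> ennreal"
    by (simp add: prod.atLeast_Suc_atMost mult.commute)
  have "(\<integral>\<^sup>+\<omega>. (\<Prod>k=1..n. g (X (take k w) \<omega>)) * G (subtree w \<omega>) \<partial>M) =
      (\<integral>\<^sup>+\<omega>. (\<Prod>j\<in>{0..n}. Y j (restrict (\<lambda>u. X u \<omega>) (K j))) \<partial>M)"
    unfolding split Y0 by (intro nn_integral_cong arg_cong2[of _ _ _ _ "(*)"] prod.cong) (auto simp: Yj)
  also have "\<dots> = (\<Prod>j\<in>{0..n}. \<integral>\<^sup>+\<omega>. Y j (restrict (\<lambda>u. X u \<omega>) (K j)) \<partial>M)"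
    using ind by (intro indep_vars_nn_integral) auto
  also have "\<dots> = (\<Prod>j=1..n. \<integral>\<^sup>+x. g x \<partial>D) * (\<integral>\<^sup>+\<omega>. G (subtree w \<omega>) \<partial>M)"
    unfolding split Y0 using Yj
    by (intro arg_cong2[of _ _ _ _ "(*)"] prod.cong) (auto simp: nn_integral_law[OF g take_nonempty_word[OF w]])
  finally show ?thesis
    by (simp add: nn_integral_subtree[OF w G])
qed

text \<open>
  The trees hanging off different children of the root, together with the weights of these children,
  use disjoint sets of weights.
\<close>

lemma nn_integral_children:
  assumes g: "g \<in> borel_measurable borel" and G: "G \<in> borel_measurable trees"
  shows "(\<integral>\<^sup>+\<omega>. (\<Prod>j<l. g (X [j] \<omega>) * G (subtree [j] \<omega>)) \<partial>M) =
    ((\<integral>\<^sup>+x. g x \<partial>D) * (\<integral>\<^sup>+\<omega>. G (subtree [] \<omega>) \<partial>M)) ^ l"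
proof -
  let ?I = "nonempty_words l"
  define K where "K j = insert [j] ((#) j ` ?I)" for j
  define Y :: "nat \<Rightarrow> (nat list \<Rightarrow> 'c) \<Rightarrow> ennreal" where
    "Y j f = g (f [j]) * G (\<lambda>v\<in>?I. f (j # v))" for j f
  have "indep_vars (\<lambda>j. Pi\<^sub>M (K j) (\<lambda>_. borel)) (\<lambda>j \<omega>. restrict (\<lambda>u. X u \<omega>) (K j)) {..<l}"
    by (intro indep_vars_restrict[OF indep])
       (auto simp: K_def nonempty_words_iff disjoint_family_on_def)
  moreover have "Y j \<in> measurable (Pi\<^sub>M (K j) (\<lambda>_. borel)) borel" for j
  proof -
    have 1: "(\<lambda>f. \<lambda>v\<in>?I. f (j # v)) \<in> measurable (Pi\<^sub>M (K j) (\<lambda>_. borel)) trees"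
      by (intro measurable_restrict measurable_component_singleton) (auto simp: K_def)
    have 2: "(\<lambda>f. f [j]) \<in> measurable (Pi\<^sub>M (K j) (\<lambda>_. borel)) borel"
      by (intro measurable_component_singleton) (auto simp: K_def)
    show ?thesis
      unfolding Y_def
      by (intro borel_measurable_times_ennreal measurable_compose[OF 1 G] measurable_compose[OF 2 g])
  qed
  ultimately have ind: "indep_vars (\<lambda>_. borel) (\<lambda>j \<omega>. Y j (restrict (\<lambda>u. X u \<omega>) (K j))) {..<l}"
    by (rule indep_vars_compose2)
  have Yj: "Y j (restrict (\<lambda>u. X u \<omega>) (K j)) = g (X [j] \<omega>) * G (subtree [j] \<omega>)" for j \<omega>
    unfolding Y_def K_def subtree_def by (auto intro!: arg_cong[of _ _ "\<lambda>f. g (X [j] \<omega>) * G f"])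
  have "(\<integral>\<^sup>+\<omega>. (\<Prod>j<l. g (X [j] \<omega>) * G (subtree [j] \<omega>)) \<partial>M) =
      (\<Prod>j<l. \<integral>\<^sup>+\<omega>. g (X [j] \<omega>) * G (subtree [j] \<omega>) \<partial>M)"
    using ind unfolding Yj by (intro indep_vars_nn_integral) auto
  also have "\<dots> = (\<Prod>j<l. (\<integral>\<^sup>+x. g x \<partial>D) * (\<integral>\<^sup>+\<omega>. G (subtree [] \<omega>) \<partial>M))"
  proof (intro prod.cong refl)
    fix j assume "j \<in> {..<l}"
    then have "[j] \<in> words l 1"
      by (auto simp: words_def)
    from nn_integral_path_subtree[OF this g G]
    show "(\<integral>\<^sup>+\<omega>. g (X [j] \<omega>) * G (subtree [j] \<omega>) \<partial>M) =
        (\<integral>\<^sup>+x. g x \<partial>D) * (\<integral>\<^sup>+\<omega>. G (subtree [] \<omega>) \<partial>M)"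
      by simp
  qed
  finally show ?thesis by simp
qed

end

section \<open>Weak convergence on cells\<close>

lemma finite_measure_integrable_continuous:
  fixes \<mu> :: "real measure" and f :: "real \<Rightarrow> real"
  assumes "finite_measure \<mu>" "sets \<mu> = sets (restrict_space borel {0..1})"
    and f: "continuous_on UNIV f" and B: "\<And>x. \<bar>f x\<bar> \<le> B"
  shows "integrable \<mu> f"
proof (rule finite_measure.integrable_const_bound[OF assms(1)])
  show "AE x in \<mu>. norm (f x) \<le> B"
    using B by simp
  have "f \<in> borel_measurable (restrict_space borel {0..1})"
    using f by (intro measurable_restrict_space1 borel_measurable_continuous_onI)
  then show "f \<in> borel_measurable \<mu>"
    by (subst measurable_cong_sets[OF assms(2) refl])
qed

text \<open>
  This setting concerns one realisation only. Weak convergence controls the mass of a cell in the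
  limit when the end points of the cell are not atoms.
\<close>

locale weakly_convergent =
  fixes \<mu>n :: "nat \<Rightarrow> real measure" and \<mu> :: "real measure"
  assumes finite_n: "\<And>n. finite_measure (\<mu>n n)" and finite_lim: "finite_measure \<mu>"
    and sets_n: "\<And>n. sets (\<mu>n n) = sets (restrict_space borel {0..1})"
    and sets_lim: "sets \<mu> = sets (restrict_space borel {0..1})"
    and conv: "\<And>f::real \<Rightarrow> real. continuous_on {0..1} f \<Longrightarrow> (\<lambda>n. \<integral>x. f x \<partial>\<mu>n n) \<longlonglongrightarrow> (\<integral>x. f x \<partial>\<mu>)"
begin

lemma space_lim: "space \<mu> = {0..1}"
  using sets_eq_imp_space_eq[OF sets_lim] by (simp add: space_restrict_space)

lemma space_n: "space (\<mu>n n) = {0..1}"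
  using sets_eq_imp_space_eq[OF sets_n] by (simp add: space_restrict_space)

lemma borel_subset_sets:
  assumes "A \<in> sets borel" "A \<subseteq> {0..1}"
  shows "A \<in> sets \<mu>" "A \<in> sets (\<mu>n n)"
  using assms by (auto simp: sets_n sets_lim sets_restrict_space image_iff intro!: bexI[of _ A])

lemma closed_set_upper:
  assumes F: "closed F" "F \<subseteq> {0..1}" and e: "e > 0"
  shows "eventually (\<lambda>n. measure (\<mu>n n) F < measure \<mu> F + e) sequentially"
proof (cases "F = {}")
  case False
  \<comment> \<open>Continuous functions that decrease to the indicator of \<open>F\<close>, because \<open>F\<close> is closed.\<close>
  define h where "h k x = max 0 (1 - real k * infdist x F)" for k x
  have h01: "0 \<le> h k x" "h k x \<le> 1" "x \<in> F \<Longrightarrow> h k x = 1" for k x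
    by (auto simp: h_def infdist_nonneg)
  have hc: "continuous_on A (h k)" for k A
    unfolding h_def by (intro continuous_intros)
  have hb: "\<bar>h k x\<bar> \<le> 1" for k x
    using h01(1,2)[of k x] by (simp add: abs_le_iff)
  have F': "F \<in> sets \<mu>" "\<And>n. F \<in> sets (\<mu>n n)"
    using F borel_subset_sets by auto
  have int_lim: "integrable \<mu> (h k)" for k
    by (rule finite_measure_integrable_continuous[OF finite_lim sets_lim hc hb])
  have int_n: "integrable (\<mu>n n) (h k)" for k n
    by (rule finite_measure_integrable_continuous[OF finite_n sets_n hc hb])
  have "(\<lambda>k. \<integral>x. h k x \<partial>\<mu>) \<longlonglongrightarrow> (\<integral>x. indicator F x \<partial>\<mu>)"
  proof (rule integral_dominated_convergence[where w = "\<lambda>_. 1"])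
    show "integrable \<mu> (\<lambda>_. 1 :: real)"
      by (rule finite_measure.integrable_const[OF finite_lim])
    show "AE x in \<mu>. (\<lambda>k. h k x) \<longlonglongrightarrow> indicator F x"
    proof (intro AE_I2)
      fix x assume "x \<in> space \<mu>"
      show "(\<lambda>k. h k x) \<longlonglongrightarrow> indicator F x"
      proof (cases "x \<in> F")
        case True
        then show ?thesis by (simp add: h01)
      next
        case xF: False
        then have pos: "infdist x F > 0"
          using F(1) False infdist_nonneg[of x F] in_closed_iff_infdist_zero[of F x] by linarith
        obtain k0 where "real k0 * infdist x F > 1"
          using reals_Archimedean3[OF pos] by blast
        then have "h k x = 0" if "k \<ge> k0" for k
          using mult_right_mono[of "real k0" "real k" "infdist x F"] that pos
          unfolding h_def by (intro max_absorb1) linarith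
        then have "eventually (\<lambda>k. h k x = indicator F x) sequentially"
          using xF by (auto simp: eventually_sequentially)
        then show ?thesis
          by (rule tendsto_eventually)
      qed
    qed
    show "\<And>k. AE x in \<mu>. norm (h k x) \<le> 1"
      using hb by simp
  qed (use int_lim F' in auto)
  then have "eventually (\<lambda>k. (\<integral>x. h k x \<partial>\<mu>) < measure \<mu> F + e) sequentially"
    using e F' by (intro order_tendstoD(2)) (auto simp: space_lim Int_absorb2[OF F(2)])
  then obtain k where k: "(\<integral>x. h k x \<partial>\<mu>) < measure \<mu> F + e"
    by (auto simp: eventually_sequentially)
  have "eventually (\<lambda>n. (\<integral>x. h k x \<partial>\<mu>n n) < measure \<mu> F + e) sequentially"
    by (rule order_tendstoD(2)[OF conv[OF hc] k])
  then show ?thesis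
  proof (rule eventually_mono)
    fix n assume *: "(\<integral>x. h k x \<partial>\<mu>n n) < measure \<mu> F + e"
    have "measure (\<mu>n n) F = (\<integral>x. indicator F x \<partial>\<mu>n n)"
      using F' by simp
    also have "\<dots> \<le> (\<integral>x. h k x \<partial>\<mu>n n)"
    proof (rule integral_mono)
      show "integrable (\<mu>n n) (\<lambda>x. indicator F x :: real)"
        using F' finite_measure.emeasure_finite[OF finite_n]
        by (intro integrable_real_indicator) (auto simp: less_top[symmetric])
    qed (use int_n h01 in \<open>auto simp: indicator_def\<close>)
    finally show "measure (\<mu>n n) F < measure \<mu> F + e"
      using * by simp
  qed
qed (use e in simp)

lemma tendsto_total: "(\<lambda>n. measure (\<mu>n n) {0..1}) \<longlonglongrightarrow> measure \<mu> {0..1}"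
  using conv[of "\<lambda>_. 1"] by (simp add: space_lim space_n)

text \<open>
  Upper bounds on the two closed sets \<open>{a..b}\<close> and \<open>{0..a} \<union> {b..1}\<close> suffice: the second one gives
  the lower bound, by complementation.
\<close>

lemma tendsto_Ico:
  assumes ab: "0 \<le> a" "a \<le> b" "b \<le> 1" and null: "measure \<mu> {a} = 0" "measure \<mu> {b} = 0"
  shows "(\<lambda>n. measure (\<mu>n n) {a..<b}) \<longlonglongrightarrow> measure \<mu> {a..<b}"
proof (rule tendstoI)
  fix e :: real assume "e > 0"
  then have e: "e / 2 > 0" by simp
  interpret lim: finite_measure \<mu> by (rule finite_lim)
  have ups: "{a..<b} \<union> ({0..a} \<union> {b..1}) = {0..1}"
    using ab by auto
  have compl: "measure \<mu> ({0..a} \<union> {b..1}) \<le> measure \<mu> {0..1} - measure \<mu> {a..<b}"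
  proof -
    have "measure \<mu> ({0..a} \<union> {b..1}) \<le> measure \<mu> ({0..1} - {a..<b}) + measure \<mu> {a}"
      using ab by (intro order_trans[OF lim.finite_measure_mono measure_Un_le])
        (auto intro!: borel_subset_sets sets.Un)
    also have "measure \<mu> ({0..1} - {a..<b}) = measure \<mu> {0..1} - measure \<mu> {a..<b}"
      using ab by (intro lim.finite_measure_Diff borel_subset_sets) auto
    finally show ?thesis using null by simp
  qed
  have up: "measure \<mu> {a..b} \<le> measure \<mu> {a..<b}"
  proof -
    have "measure \<mu> {a..b} \<le> measure \<mu> {a..<b} + measure \<mu> {b}"
      using ab by (intro order_trans[OF lim.finite_measure_mono measure_Un_le])
        (auto intro!: borel_subset_sets sets.Un)
    then show ?thesis using null by simp
  qed
  have "eventually (\<lambda>n. measure (\<mu>n n) {a..b} < measure \<mu> {a..b} + e / 2) sequentially"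
    "eventually (\<lambda>n. measure (\<mu>n n) ({0..a} \<union> {b..1}) < measure \<mu> ({0..a} \<union> {b..1}) + e / 2) sequentially"
    using ab e by (auto intro!: closed_set_upper closed_Un)
  moreover have "eventually (\<lambda>n. measure (\<mu>n n) {0..1} > measure \<mu> {0..1} - e / 2) sequentially"
    using e by (intro order_tendstoD(1)[OF tendsto_total]) simp
  ultimately show "eventually (\<lambda>n. dist (measure (\<mu>n n) {a..<b}) (measure \<mu> {a..<b}) < e) sequentially"
  proof eventually_elim
    case (elim n)
    interpret n: finite_measure "\<mu>n n" by (rule finite_n)
    have "measure (\<mu>n n) {a..<b} \<le> measure (\<mu>n n) {a..b}"
      using ab by (intro n.finite_measure_mono borel_subset_sets) auto
    moreover have "measure (\<mu>n n) {0..1} \<le> measure (\<mu>n n) {a..<b} + measure (\<mu>n n) ({0..a} \<union> {b..1})"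
      unfolding ups[symmetric] using ab
      by (intro measure_Un_le borel_subset_sets) auto
    ultimately show ?case
      using elim compl up \<open>e > 0\<close> by (simp add: dist_real_def abs_less_iff)
  qed
qed

end

section \<open>The mass of a cell\<close>

locale cascade = branching_weights M l V D
  for M :: "'a measure" and l and V :: "nat list \<Rightarrow> 'a \<Rightarrow> real" and D +
  fixes m :: "'a \<Rightarrow> real measure"
  assumes D_nonneg: "AE x in D. 0 \<le> x" and D_mean: "(\<integral>\<^sup>+x. ennreal x \<partial>D) = 1"
    and m_cascade: "mandelbrot_cascade l M V m"
begin

lemma AE_nonneg: "AE \<omega> in M. \<forall>v\<in>nonempty_words l. 0 \<le> V v \<omega>"
  by (intro AE_ball_countable'[OF _ countable_nonempty_words] AE_law[OF D_nonneg])

lemma path_weight_measurable: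
  "w \<in> words l n \<Longrightarrow> (\<lambda>\<omega>. path_weight (\<lambda>v. V v \<omega>) w) \<in> borel_measurable M"
  unfolding path_weight_def
  by (intro borel_measurable_prod X_measurable) (auto simp: length_words intro: take_nonempty_word)

lemma nn_integral_path_weight:
  assumes w: "w \<in> words l n"
  shows "(\<integral>\<^sup>+\<omega>. ennreal (path_weight (\<lambda>v. V v \<omega>) w) \<partial>M) = 1"
proof -
  have "(\<integral>\<^sup>+\<omega>. ennreal (path_weight (\<lambda>v. V v \<omega>) w) \<partial>M) =
      (\<integral>\<^sup>+\<omega>. (\<Prod>k=1..n. ennreal (V (take k w) \<omega>)) * 1 \<partial>M)"
  proof (intro nn_integral_cong_AE)
    show "AE \<omega> in M. ennreal (path_weight (\<lambda>v. V v \<omega>) w) = (\<Prod>k=1..n. ennreal (V (take k w) \<omega>)) * 1"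
      using AE_nonneg
      by eventually_elim
        (subst prod_ennreal, use take_nonempty_word[OF w] in \<open>auto simp: path_weight_def length_words[OF w]\<close>)
  qed
  also have "\<dots> = 1"
    by (subst nn_integral_path_subtree[OF w, where G = "\<lambda>_. 1"]) (auto simp: D_mean emeasure_space_1)
  finally show ?thesis .
qed

lemma sets_m: "\<omega> \<in> space M \<Longrightarrow> sets (m \<omega>) = sets (restrict_space borel {0..1})"
  and finite_m: "\<omega> \<in> space M \<Longrightarrow> finite_measure (m \<omega>)"
  and m_measurable: "A \<in> sets (restrict_space borel {0..1}) \<Longrightarrow> (\<lambda>\<omega>. emeasure (m \<omega>) A) \<in> borel_measurable M"
  using m_cascade unfolding mandelbrot_cascade_def finite_random_measure_def by auto

lemma word_interval_sets01: "w \<in> words l n \<Longrightarrow> word_interval l w \<in> sets (restrict_space borel {0..1})"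
  using word_interval_subset[OF l_ge_1, of w n] word_interval_sets[of l w]
  by (auto simp: sets_restrict_space image_iff intro!: bexI[of _ "word_interval l w"])

lemma finite_measure_cascade_approx:
  assumes "\<And>v. v \<in> nonempty_words l \<Longrightarrow> 0 \<le> V v \<omega>"
  shows "finite_measure (cascade_approx l V n \<omega>)"
proof
  have "emeasure (cascade_approx l V n \<omega>) (space (cascade_approx l V n \<omega>)) =
      (\<integral>\<^sup>+x. 1 \<partial>cascade_approx l V n \<omega>)"
    by simp
  also have "\<dots> = (\<Sum>w\<in>words l n. ennreal (path_weight (\<lambda>v. V v \<omega>) w) * emeasure lborel (word_interval l w))"
    using assms by (subst nn_integral_cascade_approx[OF l_ge_1]) auto
  also have "\<dots> < \<infinity>"
    by (simp add: emeasure_word_interval ennreal_mult_less_top)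
  finally show "emeasure (cascade_approx l V n \<omega>) (space (cascade_approx l V n \<omega>)) \<noteq> \<infinity>"
    by simp
qed

lemma AE_weakly_convergent:
  "AE \<omega> in M. weakly_convergent (\<lambda>n. cascade_approx l V n \<omega>) (m \<omega>)"
proof -
  have "AE \<omega> in M. \<forall>f::real \<Rightarrow> real. continuous_on {0..1} f \<longrightarrow>
        (\<lambda>n. \<integral>x. f x \<partial>(cascade_approx l V n \<omega>)) \<longlonglongrightarrow> (\<integral>x. f x \<partial>(m \<omega>))"
    using m_cascade unfolding mandelbrot_cascade_def by auto
  then show ?thesis
    using AE_nonneg AE_space
  proof eventually_elim
    case (elim \<omega>)
    then show ?case
      by (intro weakly_convergent.intro finite_measure_cascade_approx finite_m sets_cascade_approx sets_m) auto
  qed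
qed

text \<open>
  The expectation of every approximation is Lebesgue measure, so by Fatou's lemma the expectation
  of the limit measure is at most Lebesgue measure and has no atoms. Hence a given point is almost
  surely not an atom of the limit measure.
\<close>

lemma AE_no_atom:
  assumes x: "x \<in> {0..1}"
  shows "AE \<omega> in M. emeasure (m \<omega>) {x} = 0"
proof -
  have x_sets: "{x} \<in> sets (restrict_space borel {0..1})"
    using x by (auto simp: sets_restrict_space image_iff intro!: bexI[of _ "{x}"])
  have bound: "(\<integral>\<^sup>+\<omega>. emeasure (m \<omega>) {x} \<partial>M) \<le> ennreal (2 / real k)" if k: "k > 0" for k :: nat
  proof -
    \<comment> \<open>A tent of height \<open>1\<close> at \<open>x\<close>, supported in an interval of length \<open>2 / k\<close>.\<close>
    define h where "h t = max 0 (1 - real k * \<bar>t - x\<bar>)" for t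
    have hc: "continuous_on A h" for A
      unfolding h_def by (intro continuous_intros)
    then have h_meas [measurable]: "h \<in> borel_measurable borel"
      by (intro borel_measurable_continuous_onI)
    have h01: "0 \<le> h t" "h t \<le> 1" for t
      by (auto simp: h_def)
    have hb: "\<bar>h t\<bar> \<le> 1" for t
      using h01[of t] by simp
    define c where "c w = (\<integral>\<^sup>+t. indicator (word_interval l w) t * ennreal (h t) \<partial>lborel)" for w
    define u where "u n \<omega> = (\<Sum>w\<in>words l n. ennreal (path_weight (\<lambda>v. V v \<omega>) w) * c w)" for n \<omega>
    have u_meas: "u n \<in> borel_measurable M" for n
      unfolding u_def using path_weight_measurable by (intro borel_measurable_sum) simp
    have sum_c: "(\<Sum>w\<in>words l n. c w) \<le> ennreal (2 / real k)" for n
    proof -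
      have "(\<Sum>w\<in>words l n. c w) =
          (\<integral>\<^sup>+t. (\<Sum>w\<in>words l n. indicator (word_interval l w) t * ennreal (h t)) \<partial>lborel)"
        unfolding c_def by (rule nn_integral_sum[symmetric]) auto
      also have "\<dots> \<le> (\<integral>\<^sup>+t. indicator {x - 1 / real k..x + 1 / real k} t \<partial>lborel)"
      proof (intro nn_integral_mono)
        fix t :: real
        have "(\<Sum>w\<in>words l n. indicator (word_interval l w) t :: ennreal) =
            indicator (\<Union>w\<in>words l n. word_interval l w) t"
          by (rule indicator_UN_disjoint[symmetric])
             (auto simp: disjoint_family_on_def word_intervals_disjoint[OF l_ge_1])
        then have "(\<Sum>w\<in>words l n. indicator (word_interval l w) t * ennreal (h t)) \<le> 1 * ennreal (h t)"
          unfolding sum_distrib_right[symmetric] by (intro mult_right_mono) (auto simp: indicator_def)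
        also have "\<dots> \<le> indicator {x - 1 / real k..x + 1 / real k} t"
        proof (cases "t \<in> {x - 1 / real k..x + 1 / real k}")
          case True
          then show ?thesis using h01 by simp
        next
          case False
          then have "1 / real k \<le> \<bar>t - x\<bar>"
            by auto
          then have "1 \<le> real k * \<bar>t - x\<bar>"
            using k by (simp add: divide_le_eq mult.commute)
          then have "h t = 0"
            by (simp add: h_def)
          then show ?thesis by simp
        qed
        finally show "(\<Sum>w\<in>words l n. indicator (word_interval l w) t * ennreal (h t)) \<le>
            indicator {x - 1 / real k..x + 1 / real k} t" .
      qed
      also have "\<dots> = ennreal (2 / real k)"
        using k by simp
      finally show ?thesis .
    qed
    have int_u: "(\<integral>\<^sup>+\<omega>. u n \<omega> \<partial>M) \<le> ennreal (2 / real k)" for n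
    proof -
      have "(\<integral>\<^sup>+\<omega>. u n \<omega> \<partial>M) = (\<Sum>w\<in>words l n. (\<integral>\<^sup>+\<omega>. ennreal (path_weight (\<lambda>v. V v \<omega>) w) \<partial>M) * c w)"
        unfolding u_def using path_weight_measurable
        by (subst nn_integral_sum) (auto intro!: sum.cong nn_integral_multc)
      also have "\<dots> = (\<Sum>w\<in>words l n. c w)"
        by (intro sum.cong) (auto simp: nn_integral_path_weight)
      finally show ?thesis using sum_c by simp
    qed
    have "AE \<omega> in M. emeasure (m \<omega>) {x} \<le> liminf (\<lambda>n. u n \<omega>)"
      using AE_weakly_convergent AE_nonneg AE_space
    proof eventually_elim
      case (elim \<omega>)
      interpret weakly_convergent "\<lambda>n. cascade_approx l V n \<omega>" "m \<omega>" by (rule elim(1))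
      have int_lim: "integrable (m \<omega>) h"
        by (rule finite_measure_integrable_continuous[OF finite_lim sets_lim hc hb])
      have int_n: "integrable (cascade_approx l V n \<omega>) h" for n
        by (rule finite_measure_integrable_continuous[OF finite_n sets_n hc hb])
      have "u n \<omega> = ennreal (\<integral>t. h t \<partial>cascade_approx l V n \<omega>)" for n
        using elim(2) h01 int_n unfolding u_def c_def
        by (subst nn_integral_cascade_approx[OF l_ge_1, symmetric]) (auto intro!: nn_integral_eq_integral)
      moreover have "(\<lambda>n. ennreal (\<integral>t. h t \<partial>cascade_approx l V n \<omega>)) \<longlonglongrightarrow> ennreal (\<integral>t. h t \<partial>m \<omega>)"
        by (intro tendsto_ennrealI conv hc)
      ultimately have "liminf (\<lambda>n. u n \<omega>) = ennreal (\<integral>t. h t \<partial>m \<omega>)"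
        by (simp add: lim_imp_Liminf)
      moreover have "emeasure (m \<omega>) {x} \<le> (\<integral>\<^sup>+t. ennreal (h t) \<partial>m \<omega>)"
      proof -
        have "emeasure (m \<omega>) {x} = (\<integral>\<^sup>+t. indicator {x} t \<partial>m \<omega>)"
          using x_sets by (simp add: sets_lim)
        also have "\<dots> \<le> (\<integral>\<^sup>+t. ennreal (h t) \<partial>m \<omega>)"
          by (intro nn_integral_mono) (auto simp: indicator_def h_def)
        finally show ?thesis .
      qed
      moreover have "(\<integral>\<^sup>+t. ennreal (h t) \<partial>m \<omega>) = ennreal (\<integral>t. h t \<partial>m \<omega>)"
        using int_lim h01 by (intro nn_integral_eq_integral) auto
      ultimately show ?case by simp
    qed
    then have "(\<integral>\<^sup>+\<omega>. emeasure (m \<omega>) {x} \<partial>M) \<le> (\<integral>\<^sup>+\<omega>. liminf (\<lambda>n. u n \<omega>) \<partial>M)"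
      by (rule nn_integral_mono_AE)
    also have "\<dots> \<le> liminf (\<lambda>n. \<integral>\<^sup>+\<omega>. u n \<omega> \<partial>M)"
      by (intro nn_integral_liminf u_meas)
    also have "\<dots> \<le> liminf (\<lambda>n. ennreal (2 / real k))"
      by (intro Liminf_mono always_eventually allI int_u)
    finally show ?thesis
      by (simp add: Liminf_const)
  qed
  have "(\<integral>\<^sup>+\<omega>. emeasure (m \<omega>) {x} \<partial>M) = 0"
  proof (rule ccontr)
    assume neq: "(\<integral>\<^sup>+\<omega>. emeasure (m \<omega>) {x} \<partial>M) \<noteq> 0"
    have "(\<lambda>k. ennreal (2 / real k)) \<longlonglongrightarrow> ennreal 0"
      by (intro tendsto_ennrealI) real_asymp
    then have "eventually (\<lambda>k. ennreal (2 / real k) < (\<integral>\<^sup>+\<omega>. emeasure (m \<omega>) {x} \<partial>M) \<and> k > 0) sequentially"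
      using neq by (intro eventually_conj order_tendstoD(2) eventually_gt_at_top) (auto simp: zero_less_iff_neq_zero)
    then show False
      using bound by (auto simp: eventually_sequentially not_less[symmetric])
  qed
  then show ?thesis
    using m_measurable[OF x_sets] by (simp add: nn_integral_0_iff_AE)
qed

text \<open>
  Multiplicativity of the limit measure: the approximations on a cell are a fixed factor times the
  masses of the subtree, and they converge because almost surely the end points of no cell are
  atoms.
\<close>

lemma AE_emeasure_word_interval:
  "AE \<omega> in M. \<forall>n. \<forall>w\<in>words l n. emeasure (m \<omega>) (word_interval l w) =
     ennreal (path_weight (\<lambda>v. V v \<omega>) w / real l ^ n) * limit_mass l (\<lambda>v. V (w @ v) \<omega>)"
proof -
  have "AE \<omega> in M. emeasure (m \<omega>) (word_interval l w) =
     ennreal (path_weight (\<lambda>v. V v \<omega>) w / real l ^ n) * limit_mass l (\<lambda>v. V (w @ v) \<omega>)"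
    if w: "w \<in> words l n" for n w
  proof -
    define a b where "a = left_end l w" and "b = left_end l w + 1 / real l ^ n"
    have ab: "0 \<le> a" "a \<le> b" "b \<le> 1" and I: "word_interval l w = {a..<b}"
      using left_end_bounds[OF l_ge_1 w] by (auto simp: a_def b_def word_interval_def length_words[OF w])
    have "AE \<omega> in M. emeasure (m \<omega>) {a} = 0" "AE \<omega> in M. emeasure (m \<omega>) {b} = 0"
      using ab by (auto intro!: AE_no_atom)
    with AE_weakly_convergent AE_nonneg show ?thesis
    proof eventually_elim
      case (elim \<omega>)
      interpret weakly_convergent "\<lambda>n. cascade_approx l V n \<omega>" "m \<omega>" by (rule elim(1))
      let ?c = "ennreal (path_weight (\<lambda>v. V v \<omega>) w / real l ^ n)"
      let ?y = "\<lambda>k. ennreal (level_mass l (\<lambda>v. V (w @ v) \<omega>) k)"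
      have "(\<lambda>k. measure (cascade_approx l V k \<omega>) {a..<b}) \<longlonglongrightarrow> measure (m \<omega>) {a..<b}"
        using ab elim(3,4) by (intro tendsto_Ico) (auto simp: measure_def)
      then have "(\<lambda>k. emeasure (cascade_approx l V k \<omega>) {a..<b}) \<longlonglongrightarrow> emeasure (m \<omega>) {a..<b}"
        using tendsto_ennrealI
        by (simp add: finite_measure.emeasure_eq_measure[OF finite_n] finite_measure.emeasure_eq_measure[OF finite_lim])
      then have "(\<lambda>k. emeasure (cascade_approx l V (k + n) \<omega>) {a..<b}) \<longlonglongrightarrow> emeasure (m \<omega>) {a..<b}"
        by (rule LIMSEQ_ignore_initial_segment)
      then have lim: "(\<lambda>k. ?c * ?y k) \<longlonglongrightarrow> emeasure (m \<omega>) {a..<b}"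
        using emeasure_cascade_approx_word_interval[OF l_ge_1 _ w, of V \<omega>] elim(2)
        by (simp add: I add.commute)
      \<comment> \<open>If the factor vanishes, the masses of the subtree need not converge, but both sides are \<open>0\<close>.\<close>
      show ?case
      proof (cases "?c = 0")
        case True
        then show ?thesis
          using lim by (simp add: I LIMSEQ_const_iff)
      next
        case False
        have inv: "inverse ?c * ?c = 1" "?c * inverse ?c = 1" "inverse ?c < top"
          using False ennreal_divide_self[of ?c]
          by (auto simp: divide_ennreal_def mult.commute inverse_ennreal ennreal_eq_0_iff not_le)
        have "(\<lambda>k. inverse ?c * (?c * ?y k)) \<longlonglongrightarrow> inverse ?c * emeasure (m \<omega>) {a..<b}"
          by (intro ennreal_tendsto_cmult inv lim)
        then have "?y \<longlonglongrightarrow> inverse ?c * emeasure (m \<omega>) {a..<b}"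
          by (simp add: mult.assoc[symmetric] inv)
        then have "limit_mass l (\<lambda>v. V (w @ v) \<omega>) = inverse ?c * emeasure (m \<omega>) {a..<b}"
          unfolding limit_mass_def by (simp add: lim_imp_Liminf)
        then show ?thesis
          by (simp add: I mult.assoc[symmetric] inv)
      qed
    qed
  qed
  then show ?thesis
    by (simp add: AE_all_countable AE_ball_countable countable_finite)
qed

lemma AE_no_mass_at_1: "AE \<omega> in M. emeasure (m \<omega>) {1} = 0"
  by (rule AE_no_atom) simp

text \<open>
  The limit masses are almost surely finite, since all of them have the law of the total mass of
  \<open>m\<close>. So almost surely nothing is lost by passing to real numbers.
\<close>

definition Y :: "nat list \<Rightarrow> 'a \<Rightarrow> real" where
  "Y w \<omega> = enn2real (limit_mass l (\<lambda>v. V (w @ v) \<omega>))"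

lemma limit_mass_subtree: "limit_mass l (\<lambda>v. V (w @ v) \<omega>) = limit_mass l (subtree w \<omega>)"
  by (intro limit_mass_cong) (simp add: subtree_def)

lemma limit_mass_trees_measurable [measurable]: "limit_mass l \<in> borel_measurable trees"
  using limit_mass_measurable[of "\<lambda>x. x" l] by simp

lemma Y_eq: "Y w \<omega> = enn2real (limit_mass l (subtree w \<omega>))"
  unfolding Y_def limit_mass_subtree ..

lemma Y_nonneg: "0 \<le> Y w \<omega>"
  by (simp add: Y_def)

lemma Y_measurable: "w \<in> words l n \<Longrightarrow> Y w \<in> borel_measurable M"
  unfolding Y_eq by (intro borel_measurable_enn2real measurable_compose[OF subtree_measurable limit_mass_trees_measurable])

lemma AE_total_mass_ennreal:
  "AE \<omega> in M. limit_mass l (\<lambda>v. V ([] @ v) \<omega>) = ennreal (total_mass m \<omega>)"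
  using AE_emeasure_word_interval AE_no_mass_at_1 AE_space
proof eventually_elim
  case (elim \<omega>)
  interpret finite_measure "m \<omega>" by (rule finite_m[OF elim(3)])
  have sets: "{0..<1} \<in> sets (m \<omega>)" "{1} \<in> sets (m \<omega>)"
    by (auto simp: sets_m[OF elim(3)] sets_restrict_space image_iff
      intro: bexI[of _ "{0..<1::real}"] bexI[of _ "{1::real}"])
  have "{0..1} = {0..<1} \<union> {1::real}"
    by auto
  then have "emeasure (m \<omega>) {0..1} = emeasure (m \<omega>) {0..<1}"
    using emeasure_Un_null_set[of "{0..<1}" "m \<omega>" "{1}"] elim(2) sets by (simp add: null_sets_def)
  moreover have "emeasure (m \<omega>) {0..<1} = limit_mass l (\<lambda>v. V ([] @ v) \<omega>)"
    using elim(1)[rule_format, of "[]" 0] by (simp add: word_interval_def)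
  ultimately show ?case
    by (simp add: total_mass_def emeasure_eq_measure)
qed

lemma AE_total_mass: "AE \<omega> in M. total_mass m \<omega> = Y [] \<omega>"
  using AE_total_mass_ennreal by eventually_elim (simp add: Y_def total_mass_def)

text \<open>
  Finiteness at the root carries over to every node because the subtrees have the law of the whole
  tree.
\<close>

lemma AE_limit_mass_eq_Y: "AE \<omega> in M. \<forall>n. \<forall>w\<in>words l n. limit_mass l (\<lambda>v. V (w @ v) \<omega>) = ennreal (Y w \<omega>)"
proof -
  have "AE \<omega> in M. limit_mass l (subtree [] \<omega>) < top"
    using AE_total_mass_ennreal unfolding limit_mass_subtree by eventually_elim simp
  then have "AE \<omega> in M. limit_mass l (subtree w \<omega>) < top" if "w \<in> words l n" for w n
    by (intro AE_subtree[OF that, where P = "\<lambda>f. limit_mass l f < top"]) auto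
  then have "AE \<omega> in M. limit_mass l (\<lambda>v. V (w @ v) \<omega>) = ennreal (Y w \<omega>)" if "w \<in> words l n" for w n
    using that unfolding limit_mass_subtree Y_eq by (fastforce elim: eventually_mono)
  then show ?thesis
    by (simp add: AE_all_countable AE_ball_countable countable_finite)
qed

lemma AE_measure_word_interval:
  "AE \<omega> in M. \<forall>n. \<forall>w\<in>words l n. measure (m \<omega>) (word_interval l w) =
     path_weight (\<lambda>v. V v \<omega>) w * Y w \<omega> / real l ^ n"
  using AE_emeasure_word_interval AE_limit_mass_eq_Y AE_nonneg
proof eventually_elim
  case (elim \<omega>)
  then show ?case
    using path_weight_nonneg[of l "\<lambda>v. V v \<omega>"] Y_nonneg
    by (simp add: measure_def ennreal_mult[symmetric])
qed

lemma nn_integral_Y: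
  assumes "g \<in> borel_measurable borel"
  shows "(\<integral>\<^sup>+\<omega>. g (Y [] \<omega>) \<partial>M) = (\<integral>\<^sup>+\<omega>. g (total_mass m \<omega>) \<partial>M)"
  by (rule nn_integral_cong_AE) (use AE_total_mass in eventually_elim, simp)

text \<open>
  The recursive equation of the total mass. All estimates on the weight come from it, because the
  masses of the children are independent copies of the left-hand side.
\<close>

lemma AE_Y_children: "AE \<omega> in M. Y [] \<omega> = (\<Sum>j<l. V [j] \<omega> * Y [j] \<omega>) / real l"
  using AE_measure_word_interval AE_space
proof eventually_elim
  case (elim \<omega>)
  interpret finite_measure "m \<omega>" by (rule finite_m[OF elim(2)])
  have w1: "words l 1 = (\<lambda>j. [j]) ` {..<l}"
    by (auto simp: words_Suc)
  have "Y [] \<omega> = measure (m \<omega>) (\<Union>w\<in>words l 1. word_interval l w)"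
    using elim(1)[rule_format, of "[]" 0] unfolding UN_word_interval[OF l_ge_1]
    by (simp add: word_interval_def)
  also have "\<dots> = (\<Sum>w\<in>words l 1. measure (m \<omega>) (word_interval l w))"
    by (intro finite_measure_finite_Union)
       (auto simp: disjoint_family_on_def word_intervals_disjoint[OF l_ge_1] sets_m[OF elim(2)] intro!: word_interval_sets01)
  also have "\<dots> = (\<Sum>w\<in>words l 1. path_weight (\<lambda>v. V v \<omega>) w * Y w \<omega> / real l ^ 1)"
    by (intro sum.cong refl) (use elim(1) in blast)
  also have "\<dots> = (\<Sum>j<l. V [j] \<omega> * Y [j] \<omega> / real l)"
    unfolding w1 by (subst sum.reindex) (auto simp: inj_on_def path_weight_def)
  finally show ?case
    by (simp add: sum_divide_distrib)
qed

end

section \<open>Moment inequalities\<close>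

text \<open>
  Young's inequality up to a constant: according to whether \<open>b\<close> or \<open>a\<^sup>r\<^sup>-\<^sup>1\<close> is larger, one of the two
  terms on the right already bounds the product.
\<close>

lemma mult_le_powr_add_powr:
  fixes a b r :: real
  assumes "0 \<le> a" "0 \<le> b" "1 < r"
  shows "a * b \<le> a powr r + b powr (r / (r - 1))"
proof (cases "b \<le> a powr (r - 1)")
  case True
  have "a * b \<le> a powr 1 * a powr (r - 1)"
    using assms True by (intro mult_mono) auto
  also have "\<dots> = a powr r"
    by (simp add: powr_add[symmetric] del: powr_one_gt_zero_iff powr_one powr_one')
  finally show ?thesis by (simp add: add_increasing2)
next
  case False
  then have "a * b \<le> b powr (1 / (r - 1)) * b powr 1"
  proof (intro mult_mono)
    have "a = (a powr (r - 1)) powr (1 / (r - 1))"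
      using assms by (simp add: powr_powr)
    also have "\<dots> \<le> b powr (1 / (r - 1))"
      using False assms by (intro powr_mono2) auto
    finally show "a \<le> b powr (1 / (r - 1))" .
  qed (use assms in auto)
  also have "\<dots> = b powr (1 / (r - 1) + 1)"
    by (rule powr_add[symmetric])
  also have "1 / (r - 1) + 1 = r / (r - 1)"
    using assms by (simp add: field_simps)
  finally show ?thesis by (simp add: add_increasing)
qed

lemma powr_le_one_add_powr:
  fixes b :: real
  assumes "0 < b" "- c \<le> t" "t \<le> r"
  shows "b powr t \<le> 1 + b powr r + b powr (- c)"
proof (cases "1 \<le> b")
  case True
  then have "b powr t \<le> b powr r"
    using assms by (intro powr_mono) auto
  then show ?thesis by (simp add: add_increasing add_increasing2)
next
  case False
  then have "b powr t \<le> b powr (- c)"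
    using assms by (intro powr_mono') auto
  then show ?thesis by (simp add: add_increasing)
qed

text \<open>
  The joint law of the two variables is arbitrary, which calls for Young's inequality. It raises \<open>B\<^sup>s\<close> to the exponent
  conjugate to \<open>r\<close>, so \<open>s\<close> has to be small enough for the result to stay between the moments of order
  \<open>- c\<close> and \<open>r\<close>.
\<close>

lemma (in prob_space) product_moments_finite:
  fixes A B :: "'a \<Rightarrow> real"
  assumes [measurable]: "A \<in> borel_measurable M" "B \<in> borel_measurable M"
    and AE: "AE x in M. 0 \<le> A x" "AE x in M. 0 < B x"
    and r: "1 < r" and c: "0 < c"
    and A: "(\<integral>\<^sup>+x. ennreal (A x powr r) \<partial>M) < \<infinity>"
    and B: "(\<integral>\<^sup>+x. ennreal (B x powr r) \<partial>M) < \<infinity>" "(\<integral>\<^sup>+x. ennreal (B x powr (- c)) \<partial>M) < \<infinity>"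
  obtains s0 where "s0 > 0" "\<And>s. \<bar>s\<bar> \<le> s0 \<Longrightarrow> (\<integral>\<^sup>+x. ennreal (A x * B x powr s) \<partial>M) < \<infinity>"
proof
  define q where "q = r / (r - 1)"
  have q: "q > 0"
    using r by (simp add: q_def)
  show "min r c / q > 0"
    using r c q by simp
  fix s assume "\<bar>s\<bar> \<le> min r c / q"
  then have "\<bar>s * q\<bar> \<le> min r c"
    using q by (simp add: abs_mult le_divide_eq)
  then have sq: "- c \<le> s * q" "s * q \<le> r"
    by auto
  have "(\<integral>\<^sup>+x. ennreal (A x * B x powr s) \<partial>M) \<le>
    (\<integral>\<^sup>+x. ennreal (A x powr r) + (1 + ennreal (B x powr r) + ennreal (B x powr (- c))) \<partial>M)"
  proof (rule nn_integral_mono_AE, use AE in eventually_elim)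
    fix x assume elim: "0 \<le> A x" "0 < B x"
    have "A x * B x powr s \<le> A x powr r + (B x powr s) powr q"
      unfolding q_def using elim r by (intro mult_le_powr_add_powr) auto
    also have "(B x powr s) powr q \<le> 1 + B x powr r + B x powr (- c)"
      using elim sq by (simp add: powr_powr powr_le_one_add_powr)
    finally show "ennreal (A x * B x powr s) \<le>
        ennreal (A x powr r) + (1 + ennreal (B x powr r) + ennreal (B x powr (- c)))"
      by (simp add: ennreal_plus[symmetric] ennreal_1[symmetric] del: ennreal_plus ennreal_1)
  qed
  also have "\<dots> = (\<integral>\<^sup>+x. ennreal (A x powr r) \<partial>M) + (1 + (\<integral>\<^sup>+x. ennreal (B x powr r) \<partial>M) +
      (\<integral>\<^sup>+x. ennreal (B x powr (- c)) \<partial>M))"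
    by (simp add: nn_integral_add emeasure_space_1)
  also have "\<dots> < \<infinity>"
    using A B by simp
  finally show "(\<integral>\<^sup>+x. ennreal (A x * B x powr s) \<partial>M) < \<infinity>" .
qed

lemma abs_le_exp_add_exp:
  fixes y s :: real
  assumes "s > 0"
  shows "\<bar>y\<bar> \<le> (exp (s * y) + exp (- s * y)) / s"
proof -
  have "\<bar>s * y\<bar> \<le> exp (s * y) + exp (- s * y)"
    using exp_ge_add_one_self[of "s * y"] exp_ge_add_one_self[of "- s * y"]
      exp_gt_zero[of "s * y"] exp_gt_zero[of "- s * y"] by linarith
  then show ?thesis
    using assms by (simp add: le_divide_eq abs_mult mult.commute)
qed

text \<open>
  The remainder in Taylor's formula is at most \<open>s\<^sup>2 y\<^sup>2 exp \<bar>s y\<bar> / 2\<close>; half of the exponential room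
  \<open>s0\<close> absorbs \<open>y\<^sup>2\<close> and the other half absorbs \<open>exp \<bar>s y\<bar>\<close>.
\<close>

lemma exp_le_quadratic:
  fixes s y s0 :: real
  assumes "0 \<le> s" "s \<le> s0 / 2" "0 < s0"
  shows "exp (s * y) \<le> 1 + s * y + s\<^sup>2 * ((4 / s0\<^sup>2) * (exp (s0 * y) + exp (- s0 * y)))"
proof -
  obtain t where t: "\<bar>t\<bar> \<le> \<bar>s * y\<bar>" "exp (s * y) = 1 + s * y + exp t / 2 * (s * y)\<^sup>2"
    using Maclaurin_exp_le[of "s * y" 2] by (auto simp: numeral_2_eq_2)
  define z where "z = s0 * \<bar>y\<bar> / 2"
  have z: "0 \<le> z"
    using assms by (simp add: z_def)
  have "\<bar>s * y\<bar> \<le> z"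
    using mult_right_mono[OF assms(2), of "\<bar>y\<bar>"] assms by (simp add: z_def abs_mult)
  then have "exp t \<le> exp z"
    using t(1) by simp
  moreover have "z\<^sup>2 / 2 \<le> exp z"
    using exp_lower_Taylor_quadratic[OF z] z by linarith
  ultimately have "exp t * (z\<^sup>2 / 2) \<le> exp z * exp z"
    using z by (intro mult_mono) auto
  also have "exp z * exp z = exp (s0 * \<bar>y\<bar>)"
    by (simp add: z_def exp_add[symmetric])
  also have "\<dots> \<le> exp (s0 * y) + exp (- s0 * y)"
    by (cases "0 \<le> y") auto
  finally have *: "exp t * (z\<^sup>2 / 2) \<le> exp (s0 * y) + exp (- s0 * y)" .
  have "exp t / 2 * (s * y)\<^sup>2 = s\<^sup>2 * ((4 / s0\<^sup>2) * (exp t * (z\<^sup>2 / 2)))"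
    using assms by (simp add: z_def power_mult_distrib power_divide)
  also have "\<dots> \<le> s\<^sup>2 * ((4 / s0\<^sup>2) * (exp (s0 * y) + exp (- s0 * y)))"
    by (intro mult_left_mono *) auto
  finally show ?thesis
    using t(2) by simp
qed

text \<open>
  With density \<open>A\<close>, the moment generating function of \<open>L\<close> is \<open>1 + s \<mu> + O(s\<^sup>2)\<close> near \<open>0\<close>, hence
  lies below \<open>exp (s (\<mu> + \<delta>))\<close> for small \<open>s > 0\<close>. This is the input to Chernoff bounds.
\<close>

lemma (in prob_space) exponential_moment_bound:
  fixes A L :: "'a \<Rightarrow> real"
  assumes [measurable]: "A \<in> borel_measurable M" "L \<in> borel_measurable M"
    and nonneg: "AE x in M. 0 \<le> A x" and A1: "(\<integral>\<^sup>+x. ennreal (A x) \<partial>M) = 1"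
    and s0: "s0 > 0" and fin: "\<And>s. \<bar>s\<bar> \<le> s0 \<Longrightarrow> (\<integral>\<^sup>+x. ennreal (A x * exp (s * L x)) \<partial>M) < \<infinity>"
  shows "integrable M (\<lambda>x. A x * L x)"
    and "\<delta> > 0 \<Longrightarrow> \<exists>s>0. s \<le> s0 \<and>
      (\<integral>\<^sup>+x. ennreal (A x * exp (s * L x)) \<partial>M) < ennreal (exp (s * (expectation (\<lambda>x. A x * L x) + \<delta>)))"
proof -
  have int_exp: "integrable M (\<lambda>x. A x * exp (s * L x))" if "\<bar>s\<bar> \<le> s0" for s
    using fin[OF that] nonneg by (intro integrableI_nonneg) auto
  have int_A: "integrable M A" "expectation A = 1"
    using A1 nonneg by (auto intro!: integrableI_nonneg simp: integral_eq_nn_integral)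
  define H where "H x = A x * exp (s0 * L x) + A x * exp (- s0 * L x)" for x
  have int_H: "integrable M H"
    unfolding H_def using s0 by (intro Bochner_Integration.integrable_add int_exp) auto
  show int_AL: "integrable M (\<lambda>x. A x * L x)"
  proof (rule Bochner_Integration.integrable_bound[of _ "\<lambda>x. H x / s0"])
    show "integrable M (\<lambda>x. H x / s0)"
      using int_H by simp
    show "AE x in M. norm (A x * L x) \<le> norm (H x / s0)"
      using nonneg
    proof eventually_elim
      case (elim x)
      have "norm (A x * L x) = A x * \<bar>L x\<bar>"
        using elim by (simp add: abs_mult)
      also have "\<dots> \<le> A x * ((exp (s0 * L x) + exp (- s0 * L x)) / s0)"
        by (intro mult_left_mono abs_le_exp_add_exp s0 elim)
      also have "\<dots> = H x / s0"
        by (simp add: H_def algebra_simps)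
      also have "\<dots> \<le> norm (H x / s0)"
        unfolding real_norm_def by (rule abs_ge_self)
      finally show ?case .
    qed
  qed simp
  assume \<delta>: "\<delta> > 0"
  define \<mu> where "\<mu> = expectation (\<lambda>x. A x * L x)"
  define C where "C = 4 / s0\<^sup>2 * expectation H"
  have C: "C \<ge> 0"
    unfolding C_def H_def using nonneg by (intro mult_nonneg_nonneg integral_nonneg_AE) auto
  \<comment> \<open>The second bound makes the quadratic term \<open>C s\<^sup>2\<close> smaller than \<open>s \<delta>\<close>.\<close>
  define s where "s = min (s0 / 2) (\<delta> / (C + 1))"
  have s: "0 < s" "s \<le> s0 / 2" "s \<le> \<delta> / (C + 1)"
    using s0 \<delta> C by (simp_all only: s_def min.cobounded1 min.cobounded2) simp
  have "C * s < (C + 1) * s"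
    using s by simp
  also have "\<dots> \<le> \<delta>"
    using s(3) C by (simp add: le_divide_eq mult.commute)
  finally have Cs: "C * s < \<delta>" .
  have "(\<integral>\<^sup>+x. ennreal (A x * exp (s * L x)) \<partial>M) = ennreal (expectation (\<lambda>x. A x * exp (s * L x)))"
    using int_exp[of s] s s0 nonneg by (intro nn_integral_eq_integral) auto
  also have "expectation (\<lambda>x. A x * exp (s * L x)) \<le>
      expectation (\<lambda>x. A x + s * (A x * L x) + s\<^sup>2 * (4 / s0\<^sup>2 * H x))"
  proof (rule integral_mono_AE)
    show "AE x in M. A x * exp (s * L x) \<le> A x + s * (A x * L x) + s\<^sup>2 * (4 / s0\<^sup>2 * H x)"
      using nonneg
    proof eventually_elim
      case (elim x)
      have "A x * exp (s * L x) \<le>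
          A x * (1 + s * L x + s\<^sup>2 * ((4 / s0\<^sup>2) * (exp (s0 * L x) + exp (- s0 * L x))))"
        using s s0 by (intro mult_left_mono elim exp_le_quadratic) auto
      then show ?case
        by (simp add: H_def algebra_simps)
    qed
  qed (use int_exp[of s] s s0 int_A int_AL int_H in auto)
  also have "\<dots> = 1 + s * \<mu> + s\<^sup>2 * C"
    using int_A int_AL int_H by (simp add: \<mu>_def C_def)
  also have "\<dots> = 1 + s * (\<mu> + C * s)"
    by (simp add: power2_eq_square algebra_simps)
  also have "\<dots> \<le> exp (s * (\<mu> + C * s))"
    by (rule exp_ge_add_one_self)
  also have "ennreal \<dots> < ennreal (exp (s * (\<mu> + \<delta>)))"
    using s Cs by (intro ennreal_lessI) auto
  finally have "(\<integral>\<^sup>+x. ennreal (A x * exp (s * L x)) \<partial>M) < ennreal (exp (s * (\<mu> + \<delta>)))"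
    by (simp add: ennreal_leI)
  then show "\<exists>s>0. s \<le> s0 \<and>
      (\<integral>\<^sup>+x. ennreal (A x * exp (s * L x)) \<partial>M) < ennreal (exp (s * (expectation (\<lambda>x. A x * L x) + \<delta>)))"
    using s s0 unfolding \<mu>_def by (intro exI[of _ s]) auto
qed

text \<open>
  A power bound on the distribution function at \<open>0\<close> gives negative moments, by summing over the
  dyadic shells \<open>1 / 2 ^ (k + 1) < x \<le> 1 / 2 ^ k\<close>. Half of the exponent is given up to make the
  resulting geometric series converge.
\<close>

lemma negative_moment_of_small_ball:
  fixes M :: "real measure"
  assumes "prob_space M" and sets: "sets M = sets borel"
    and b: "b > 0" and small: "\<And>u. u > 0 \<Longrightarrow> measure M {..u} \<le> C * u powr (2 * b)"
  shows "AE x in M. 0 < x" and "(\<integral>\<^sup>+x. ennreal (x powr (- b)) \<partial>M) < \<infinity>"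
proof -
  interpret prob_space M by fact
  have Iic: "{..u::real} \<in> sets M" for u
    by (simp add: sets)
  have "C \<ge> 0"
    using order_trans[OF measure_nonneg small[of 1]] by simp
  have "measure M {..0} \<le> 0"
  proof (rule tendsto_lowerbound)
    show "((\<lambda>u. C * u powr (2 * b)) \<longlongrightarrow> 0) (at_right 0)"
      using b by real_asymp
    show "eventually (\<lambda>u. measure M {..0} \<le> C * u powr (2 * b)) (at_right 0)"
      unfolding eventually_at_right_field
    proof (intro exI[of _ 1] conjI allI impI)
      fix u :: real assume "0 < u" "u < 1"
      then show "measure M {..0} \<le> C * u powr (2 * b)"
        by (intro order_trans[OF finite_measure_mono small] Iic) auto
    qed simp
  qed simp
  then have "{..0} \<in> null_sets M"
    using Iic[of 0] by (auto simp: null_sets_def emeasure_eq_measure order_antisym)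
  then have "AE x in M. x \<notin> {..0}"
    by (rule AE_not_in)
  then show pos: "AE x in M. 0 < x"
    by (simp add: not_le)
  let ?h = "\<lambda>k. (2 ^ Suc k) powr b :: real"
  have "(\<integral>\<^sup>+x. ennreal (x powr (- b)) \<partial>M) \<le>
      (\<integral>\<^sup>+x. 1 + (\<Sum>k. ennreal (?h k) * indicator {..1 / 2 ^ k} x) \<partial>M)"
  proof (rule nn_integral_mono_AE, use pos in eventually_elim)
    fix x :: real assume elim: "0 < x"
    show "ennreal (x powr (- b)) \<le> 1 + (\<Sum>k. ennreal (?h k) * indicator {..1 / 2 ^ k} x)"
    proof (cases "x > 1")
      case True
      then have "x powr (- b) \<le> 1"
        using b by (simp add: powr_minus_divide divide_le_eq ge_one_powr_ge_zero)
      then have "ennreal (x powr (- b)) \<le> 1"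
        by simp
      then show ?thesis
        by (rule order_trans) simp
    next
      case False
      obtain k0 where "(1 / 2) ^ k0 < x"
        using real_arch_pow_inv[OF elim, of "1 / 2"] by auto
      moreover have "(1 / 2) ^ Suc k0 \<le> (1 / 2 :: real) ^ k0"
        by simp
      ultimately have ex: "(1 / 2) ^ Suc k0 < x"
        by linarith
      define k where "k = (LEAST k. (1 / 2) ^ Suc k < x)"
      have k1: "(1 / 2) ^ Suc k < x"
        unfolding k_def by (rule LeastI[of _ k0]) (rule ex)
      have k2: "x \<le> 1 / 2 ^ k"
      proof (cases k)
        case (Suc j)
        then have "\<not> (1 / 2) ^ Suc j < x"
          using not_less_Least[of j "\<lambda>k. (1 / 2) ^ Suc k < x"] by (simp add: k_def)
        then show ?thesis
          using Suc by (simp add: power_divide)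
      qed (use False in simp)
      have "x powr (- b) \<le> ((1 / 2) ^ Suc k) powr (- b)"
        using k1 b by (intro powr_mono2') auto
      also have "\<dots> = ?h k"
        by (simp add: powr_minus_divide power_divide powr_divide)
      finally have "ennreal (x powr (- b)) \<le> ennreal (?h k) * indicator {..1 / 2 ^ k} x"
        using k2 by (simp add: ennreal_leI)
      also have "\<dots> = (\<Sum>k\<in>{k}. ennreal (?h k) * indicator {..1 / 2 ^ k} x)"
        by (simp only: sum.insert[OF finite.emptyI] empty_iff sum.empty not_False_eq_True add_0_right)
      also have "\<dots> \<le> (\<Sum>k. ennreal (?h k) * indicator {..1 / 2 ^ k} x)"
        by (intro sum_le_suminf) auto
      also have "\<dots> \<le> 1 + \<dots>"
        by simp
      finally show ?thesis .
    qed
  qed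
  also have "\<dots> = 1 + (\<Sum>k. ennreal (?h k) * emeasure M {..1 / 2 ^ k})"
    by (subst nn_integral_add)
       (auto simp: nn_integral_suminf nn_integral_cmult Iic emeasure_space_1 measurable_cong_sets[OF sets refl])
  also have "\<dots> \<le> 1 + (\<Sum>k. ennreal (C * 2 powr b * (2 powr (- b)) ^ k))"
  proof (intro add_left_mono suminf_le)
    fix k
    have p2: "(2 ^ j) powr t = (2 powr t) ^ j" for j and t :: real
      by (simp add: powr_powr powr_realpow[symmetric] mult.commute)
    have "?h k * measure M {..1 / 2 ^ k} \<le> ?h k * (C * (1 / 2 ^ k) powr (2 * b))"
      by (intro mult_left_mono small) auto
    also have "(1 / 2 ^ k) powr (2 * b) = (2 powr (- b)) ^ k * (2 powr (- b)) ^ k"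
      by (simp add: powr_divide p2 powr_minus_divide power_mult_distrib[symmetric] powr_add[symmetric] power_one_over)
    also have "?h k * (C * ((2 powr (- b)) ^ k * (2 powr (- b)) ^ k)) =
        C * 2 powr b * (2 powr (- b)) ^ k * (2 powr b * 2 powr (- b)) ^ k"
      unfolding p2 by (simp add: power_mult_distrib)
    also have "2 powr b * 2 powr (- b) = (1 :: real)"
      by (simp add: powr_minus)
    finally have "?h k * measure M {..1 / 2 ^ k} \<le> C * 2 powr b * (2 powr (- b)) ^ k"
      by simp
    then show "ennreal (?h k) * emeasure M {..1 / 2 ^ k} \<le> ennreal (C * 2 powr b * (2 powr (- b)) ^ k)"
      by (simp add: emeasure_eq_measure ennreal_mult'[symmetric] ennreal_leI)
  qed auto
  also have "\<dots> < \<infinity>"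
  proof -
    have "summable (\<lambda>k. C * 2 powr b * (2 powr (- b)) ^ k)"
      using b by (intro summable_mult summable_geometric) (simp add: powr_less_one)
    then have "(\<Sum>k. ennreal (C * 2 powr b * (2 powr (- b)) ^ k)) \<noteq> top"
      using \<open>C \<ge> 0\<close> by (intro ennreal_suminf_neq_top) auto
    then show ?thesis
      by (simp add: less_top)
  qed
  finally show "(\<integral>\<^sup>+x. ennreal (x powr (- b)) \<partial>M) < \<infinity>" .
qed

section \<open>Moments of the weights\<close>

context cascade begin

lemma prob_space_D: "prob_space D"
proof -
  obtain w where "w \<in> nonempty_words l"
    using nonempty_words_not_empty by blast
  then show ?thesis
    using prob_space_distr[OF X_measurable] law by metis
qed

lemma sets_D: "sets D = sets borel"
  using law nonempty_words_not_empty by (metis all_not_in_conv sets_distr)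

lemma singleton_word: "j < l \<Longrightarrow> [j] \<in> words l 1"
  by (auto simp: words_def)

lemma nn_integral_Y_powr_neq_0:
  assumes "nondegenerate M m"
  shows "(\<integral>\<^sup>+\<omega>. ennreal (Y [] \<omega> powr r) \<partial>M) \<noteq> 0"
proof
  assume "(\<integral>\<^sup>+\<omega>. ennreal (Y [] \<omega> powr r) \<partial>M) = 0"
  then have "AE \<omega> in M. ennreal (Y [] \<omega> powr r) = 0"
    using Y_measurable[of "[]" 0] by (subst (asm) nn_integral_0_iff_AE) auto
  with AE_total_mass AE_space have "AE \<omega> in M. emeasure (m \<omega>) {0..1} = 0"
  proof eventually_elim
    case (elim \<omega>)
    then have "total_mass m \<omega> = 0"
      by simp
    then show ?case
      using finite_measure.emeasure_eq_measure[OF finite_m[OF elim(2)]] by (simp add: total_mass_def)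
  qed
  then have "(\<integral>\<^sup>+\<omega>. emeasure (m \<omega>) {0..1} \<partial>M) = (\<integral>\<^sup>+\<omega>. 0 \<partial>M)"
    by (rule nn_integral_cong_AE)
  then show False
    using assms by (simp add: nondegenerate_def)
qed

text \<open>
  A single child already bounds the total mass from below: \<open>Y \<ge> V Y\<^sub>0 / l\<close>, where \<open>V\<close> is
  independent of \<open>Y\<^sub>0\<close> and \<open>Y\<^sub>0\<close> has the law of \<open>Y\<close>. So the weight inherits the moments of \<open>Y\<close>.
\<close>

lemma weight_moment_finite:
  assumes nondeg: "nondegenerate M m" and r: "r > 0"
    and fin: "(\<integral>\<^sup>+\<omega>. ennreal (total_mass m \<omega> powr r) \<partial>M) < \<infinity>"
  shows "(\<integral>\<^sup>+x. ennreal (x powr r) \<partial>D) < \<infinity>"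
proof -
  let ?E = "\<integral>\<^sup>+\<omega>. ennreal (Y [] \<omega> powr r) \<partial>M"
  have w: "[0] \<in> words l 1"
    using l_ge_2 by (intro singleton_word) simp
  have g: "(\<lambda>x. ennreal (x powr r)) \<in> borel_measurable borel"
    by measurable
  have G: "(\<lambda>f. ennreal (enn2real (limit_mass l f) powr r)) \<in> borel_measurable trees"
    by measurable
  have E: "?E < \<infinity>" "?E \<noteq> 0"
    by (use fin nn_integral_Y[OF g] in simp) (rule nn_integral_Y_powr_neq_0[OF nondeg])
  have "(\<integral>\<^sup>+x. ennreal (x powr r) \<partial>D) * ?E =
      (\<integral>\<^sup>+\<omega>. ennreal (V [0] \<omega> powr r) * ennreal (Y [0] \<omega> powr r) \<partial>M)"
    using nn_integral_path_subtree[OF w g G] by (simp add: Y_eq)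
  also have "\<dots> \<le> (\<integral>\<^sup>+\<omega>. ennreal (real l powr r) * ennreal (Y [] \<omega> powr r) \<partial>M)"
  proof (rule nn_integral_mono_AE, use AE_Y_children AE_nonneg in eventually_elim)
    fix \<omega> assume \<omega>: "Y [] \<omega> = (\<Sum>j<l. V [j] \<omega> * Y [j] \<omega>) / real l" "\<forall>v\<in>nonempty_words l. 0 \<le> V v \<omega>"
    have V: "0 \<le> V [j] \<omega>" if "j < l" for j
      using \<omega>(2) that by (auto simp: nonempty_words_iff)
    have "V [0] \<omega> * Y [0] \<omega> \<le> (\<Sum>j<l. V [j] \<omega> * Y [j] \<omega>)"
      using V Y_nonneg l_ge_2 by (intro member_le_sum) auto
    also have "\<dots> = real l * Y [] \<omega>"
      using \<omega>(1) l_ge_2 by simp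
    finally have "(V [0] \<omega> * Y [0] \<omega>) powr r \<le> (real l * Y [] \<omega>) powr r"
      using V[of 0] Y_nonneg l_ge_2 r by (intro powr_mono2) auto
    then show "ennreal (V [0] \<omega> powr r) * ennreal (Y [0] \<omega> powr r) \<le>
        ennreal (real l powr r) * ennreal (Y [] \<omega> powr r)"
      using V[of 0] Y_nonneg l_ge_2 by (simp add: ennreal_mult'[symmetric] powr_mult ennreal_leI)
  qed
  also have "\<dots> = ennreal (real l powr r) * ?E"
    using Y_measurable[of "[]" 0] by (intro nn_integral_cmult) auto
  also have "\<dots> < \<infinity>"
    using E by (simp add: ennreal_mult_less_top)
  finally show ?thesis
    using E by (auto simp: ennreal_mult_less_top)
qed

text \<open>
  In \<open>ennreal\<close> the inverse of \<open>0\<close> is \<open>\<infinity>\<close>, so a finite negative moment excludes the value \<open>0\<close>.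
\<close>

lemma AE_Y_pos:
  assumes \<alpha>: "\<alpha> > 0" and fin: "(\<integral>\<^sup>+\<omega>. inverse (ennreal (total_mass m \<omega> powr \<alpha>)) \<partial>M) < \<infinity>"
  shows "AE \<omega> in M. \<forall>n. \<forall>w\<in>words l n. 0 < Y w \<omega>"
proof -
  have "(\<integral>\<^sup>+\<omega>. inverse (ennreal (Y [] \<omega> powr \<alpha>)) \<partial>M) < \<infinity>"
    using fin nn_integral_Y[of "\<lambda>x. inverse (ennreal (x powr \<alpha>))"] by simp
  then have "AE \<omega> in M. inverse (ennreal (Y [] \<omega> powr \<alpha>)) \<noteq> \<infinity>"
    using Y_measurable[of "[]" 0] by (intro nn_integral_noteq_infinite) auto
  then have "AE \<omega> in M. 0 < enn2real (limit_mass l (subtree [] \<omega>))"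
    unfolding Y_eq[symmetric]
  proof eventually_elim
    case (elim \<omega>)
    then have "Y [] \<omega> \<noteq> 0"
      by auto
    then show ?case
      using Y_nonneg[of "[]" \<omega>] by simp
  qed
  then have "AE \<omega> in M. 0 < enn2real (limit_mass l (subtree w \<omega>))" if "w \<in> words l n" for w n
    by (intro AE_subtree[OF that, where P = "\<lambda>f. 0 < enn2real (limit_mass l f)"]) measurable
  then show ?thesis
    unfolding Y_eq by (simp add: AE_all_countable AE_ball_countable countable_finite)
qed

lemma nn_integral_Y_negative_moment:
  assumes \<alpha>: "\<alpha> > 0" and fin: "(\<integral>\<^sup>+\<omega>. inverse (ennreal (total_mass m \<omega> powr \<alpha>)) \<partial>M) < \<infinity>"
  shows "(\<integral>\<^sup>+\<omega>. ennreal (Y [] \<omega> powr (- \<alpha>)) \<partial>M) < \<infinity>"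
proof -
  have "(\<integral>\<^sup>+\<omega>. ennreal (Y [] \<omega> powr (- \<alpha>)) \<partial>M) = (\<integral>\<^sup>+\<omega>. inverse (ennreal (Y [] \<omega> powr \<alpha>)) \<partial>M)"
  proof (rule nn_integral_cong_AE, use AE_Y_pos[OF \<alpha> fin] in eventually_elim)
    fix \<omega> assume "\<forall>n. \<forall>w\<in>words l n. 0 < Y w \<omega>"
    then have "0 < Y [] \<omega>"
      by (auto dest: spec[of _ 0])
    then show "ennreal (Y [] \<omega> powr (- \<alpha>)) = inverse (ennreal (Y [] \<omega> powr \<alpha>))"
      by (simp add: inverse_ennreal powr_minus)
  qed
  then show ?thesis
    using fin nn_integral_Y[of "\<lambda>x. inverse (ennreal (x powr \<alpha>))"] by simp
qed

text \<open>
  If all first weights are at most \<open>u\<close> and all masses below the root are at most \<open>K\<close>, then the total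
  mass is at most \<open>u K\<close>. By independence this happens with probability \<open>(P(V \<le> u) P(Y \<le> K))\<^sup>l\<close>, and
  Markov's inequality for \<open>Y\<^sup>-\<^sup>\<alpha>\<close> bounds it by a multiple of \<open>u\<^sup>\<alpha>\<close>.
\<close>

lemma weight_small_ball:
  assumes \<alpha>: "\<alpha> > 0" and fin: "(\<integral>\<^sup>+\<omega>. inverse (ennreal (total_mass m \<omega> powr \<alpha>)) \<partial>M) < \<infinity>"
  obtains C where "\<And>u. u > 0 \<Longrightarrow> measure D {..u} \<le> C * u powr (\<alpha> / real l)"
proof -
  interpret D: prob_space D by (rule prob_space_D)
  let ?G = "\<lambda>K f. indicator {f \<in> space trees. enn2real (limit_mass l f) \<le> K} f :: ennreal"
  define q where "q K = measure M {\<omega> \<in> space M. Y [] \<omega> \<le> K}" for K :: real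
  have Y_meas: "Y [] \<in> borel_measurable M"
    by (rule Y_measurable[of "[]" 0]) simp
  have G: "?G K \<in> borel_measurable trees" for K
    by measurable
  have G_subtree: "?G K (subtree w \<omega>) = indicator {\<omega> \<in> space M. Y w \<omega> \<le> K} \<omega>"
    if "w \<in> words l n" "\<omega> \<in> space M" for w n K \<omega>
    using that measurable_space[OF subtree_measurable[OF that(1)] that(2)] by (simp add: indicator_def Y_eq)
  have int_G: "(\<integral>\<^sup>+\<omega>. ?G K (subtree [] \<omega>) \<partial>M) = ennreal (q K)" for K
  proof -
    have "(\<integral>\<^sup>+\<omega>. ?G K (subtree [] \<omega>) \<partial>M) = (\<integral>\<^sup>+\<omega>. indicator {\<omega> \<in> space M. Y [] \<omega> \<le> K} \<omega> \<partial>M)"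
      by (intro nn_integral_cong G_subtree[of "[]" 0]) auto
    also have "\<dots> = ennreal (q K)"
      using Y_meas by (subst nn_integral_indicator) (auto simp: q_def emeasure_eq_measure)
    finally show ?thesis .
  qed
  \<comment> \<open>A level below which the total mass stays with positive probability.\<close>
  obtain K where K: "K > 0" "q K > 0"
  proof -
    have "\<exists>k::nat. q (real k) > 0"
    proof (rule ccontr)
      assume "\<not> (\<exists>k::nat. q (real k) > 0)"
      then have "q (real k) = 0" for k
        using measure_nonneg[of M] unfolding q_def by (metis antisym_conv2)
      then have "{\<omega> \<in> space M. Y [] \<omega> \<le> real k} \<in> null_sets M" for k
        using Y_meas by (auto simp: null_sets_def emeasure_eq_measure q_def)
      then have "AE \<omega> in M. \<forall>k. \<omega> \<notin> {\<omega> \<in> space M. Y [] \<omega> \<le> real k}"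
        unfolding AE_all_countable by (intro allI AE_not_in)
      with AE_space have "AE \<omega> in M. False"
      proof eventually_elim
        case (elim \<omega>)
        obtain k where "Y [] \<omega> \<le> real k"
          using real_arch_simple by blast
        then show ?case
          using elim by auto
      qed
      then show False
        by simp
    qed
    then obtain k :: nat where "q (real k) > 0" by blast
    moreover have "q (real k) \<le> q (real k + 1)"
      unfolding q_def using Y_meas by (intro finite_measure_mono) auto
    ultimately show ?thesis
      by (intro that[of "real k + 1"]) auto
  qed
  define c where "c = enn2real (\<integral>\<^sup>+\<omega>. ennreal (Y [] \<omega> powr (- \<alpha>)) \<partial>M)"
  have c: "(\<integral>\<^sup>+\<omega>. ennreal (Y [] \<omega> powr (- \<alpha>)) \<partial>M) = ennreal c" "c \<ge> 0"
    using nn_integral_Y_negative_moment[OF \<alpha> fin] by (auto simp: c_def less_top)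
  show ?thesis
  proof (rule that)
    fix u :: real assume u: "u > 0"
    let ?p = "measure D {..u}"
    have g: "indicator {..u} \<in> borel_measurable borel"
      by measurable
    have "ennreal ((?p * q K) ^ l) = ((\<integral>\<^sup>+x. indicator {..u} x \<partial>D) * (\<integral>\<^sup>+\<omega>. ?G K (subtree [] \<omega>) \<partial>M)) ^ l"
      unfolding int_G
      by (subst nn_integral_indicator)
         (auto simp: sets_D D.emeasure_eq_measure q_def ennreal_mult'[symmetric] ennreal_power)
    also have "\<dots> = (\<integral>\<^sup>+\<omega>. (\<Prod>j<l. indicator {..u} (V [j] \<omega>) * ?G K (subtree [j] \<omega>)) \<partial>M)"
      by (rule nn_integral_children[OF g G, symmetric])
    also have "\<dots> \<le> (\<integral>\<^sup>+\<omega>. ennreal ((u * K) powr \<alpha>) * ennreal (Y [] \<omega> powr (- \<alpha>)) \<partial>M)"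
    proof (rule nn_integral_mono_AE, use AE_Y_children AE_nonneg AE_Y_pos[OF \<alpha> fin] AE_space in eventually_elim)
      fix \<omega> assume \<omega>: "Y [] \<omega> = (\<Sum>j<l. V [j] \<omega> * Y [j] \<omega>) / real l" "\<forall>v\<in>nonempty_words l. 0 \<le> V v \<omega>"
        "\<forall>n. \<forall>w\<in>words l n. 0 < Y w \<omega>" "\<omega> \<in> space M"
      show "(\<Prod>j<l. indicator {..u} (V [j] \<omega>) * ?G K (subtree [j] \<omega>)) \<le>
          ennreal ((u * K) powr \<alpha>) * ennreal (Y [] \<omega> powr (- \<alpha>))"
      proof (cases "\<forall>j<l. V [j] \<omega> \<le> u \<and> Y [j] \<omega> \<le> K")
        case True
        have "(\<Sum>j<l. V [j] \<omega> * Y [j] \<omega>) \<le> (\<Sum>j<l. u * K)"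
          using True u K \<omega>(2) Y_nonneg
          by (intro sum_mono mult_mono) (auto simp: nonempty_words_iff)
        then have "Y [] \<omega> \<le> u * K"
          using l_ge_2 by (simp add: \<omega>(1) divide_le_eq mult.commute)
        moreover have pos: "0 < Y [] \<omega>"
          using \<omega>(3) by (auto dest: spec[of _ 0])
        ultimately have "Y [] \<omega> powr \<alpha> \<le> (u * K) powr \<alpha>"
          using \<alpha> by (intro powr_mono2) auto
        then have "1 \<le> (u * K) powr \<alpha> * Y [] \<omega> powr (- \<alpha>)"
          using pos by (simp add: powr_minus_divide le_divide_eq)
        then have "1 \<le> ennreal ((u * K) powr \<alpha>) * ennreal (Y [] \<omega> powr (- \<alpha>))"
          by (simp add: ennreal_mult'[symmetric])
        moreover have "(\<Prod>j<l. indicator {..u} (V [j] \<omega>) * ?G K (subtree [j] \<omega>)) \<le> 1"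
          by (intro prod_le_1) (auto simp: indicator_def)
        ultimately show ?thesis
          by (rule order_trans[rotated])
      next
        case False
        then obtain j where j: "j < l" "\<not> (V [j] \<omega> \<le> u \<and> Y [j] \<omega> \<le> K)"
          by blast
        then have "indicator {..u} (V [j] \<omega>) * ?G K (subtree [j] \<omega>) = 0"
          using \<omega>(4) by (subst G_subtree[OF singleton_word]) (auto simp: indicator_def)
        then have "(\<Prod>j<l. indicator {..u} (V [j] \<omega>) * ?G K (subtree [j] \<omega>)) = 0"
          using j by (intro prod_zero) auto
        then show ?thesis by (simp only: zero_le)
      qed
    qed
    also have "\<dots> = ennreal ((u * K) powr \<alpha>) * ennreal c"
      using Y_meas by (subst nn_integral_cmult) (auto simp: c)
    finally have "(?p * q K) ^ l \<le> (u * K) powr \<alpha> * c"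
      using c by (simp add: ennreal_mult'[symmetric])
    then have "(?p * q K) powr real l \<le> (u * K) powr \<alpha> * c"
      using K l_ge_2 by (subst powr_realpow') auto
    then have "((?p * q K) powr real l) powr (1 / real l) \<le> ((u * K) powr \<alpha> * c) powr (1 / real l)"
      by (intro powr_mono2) auto
    then have "?p * q K \<le> (u powr \<alpha> * (K powr \<alpha> * c)) powr (1 / real l)"
      using K u l_ge_2 by (simp add: powr_powr powr_mult mult.assoc)
    also have "\<dots> = u powr (\<alpha> / real l) * (K powr \<alpha> * c) powr (1 / real l)"
      using c by (simp add: powr_mult powr_powr)
    finally show "?p \<le> (K powr \<alpha> * c) powr (1 / real l) / q K * u powr (\<alpha> / real l)"
      using K by (simp add: le_divide_eq mult.commute)
  qed
qed

end

section \<open>The masses along a typical point\<close>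

text \<open>
  Negative powers of the weights and of the masses occur below. They behave as expected only at
  positive arguments, because \<open>0 powr s = 0\<close> for every \<open>s\<close>; hence the two assumptions on positivity.
\<close>

locale cascade_pair =
  pair: branching_weights M l "\<lambda>w \<omega>. (V w \<omega>, V' w \<omega>)" D +
  C: cascade M l V D1 m + C': cascade M l V' D1' m'
  for M :: "'a measure" and l V V' and D :: "(real \<times> real) measure" and D1 m D1' m' +
  assumes D_pos: "AE p in D. 0 < fst p \<and> 0 \<le> snd p"
    and Y_pos: "AE \<omega> in M. \<forall>n. \<forall>w\<in>words l n. 0 < C.Y w \<omega>"
begin

text \<open>
  Almost surely, \<open>Z w \<omega>\<close> is \<open>m \<omega> (word_interval l w)\<close> divided by the length of the interval.
\<close>

definition Z :: "nat list \<Rightarrow> 'a \<Rightarrow> real" where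
  "Z w \<omega> = path_weight (\<lambda>v. V v \<omega>) w * C.Y w \<omega>"

lemma Z_measurable: "w \<in> words l n \<Longrightarrow> Z w \<in> borel_measurable M"
  unfolding Z_def by (intro borel_measurable_times C.path_weight_measurable C.Y_measurable)

lemma AE_weights_pos:
  "AE \<omega> in M. \<forall>v\<in>nonempty_words l. 0 < V v \<omega> \<and> 0 \<le> V' v \<omega>"
  using pair.AE_law[OF D_pos] by (intro AE_ball_countable'[OF _ countable_nonempty_words]) auto

lemma AE_Z_pos: "AE \<omega> in M. \<forall>n. \<forall>w\<in>words l n. 0 < Z w \<omega>"
  using AE_weights_pos Y_pos
proof eventually_elim
  case (elim \<omega>)
  show ?case
  proof (intro allI ballI)
    fix n w assume w: "w \<in> words l n"
    have "0 < path_weight (\<lambda>v. V v \<omega>) w"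
      unfolding path_weight_def using elim(1) take_nonempty_word[OF w] length_words[OF w]
      by (intro prod_pos) auto
    then show "0 < Z w \<omega>"
      using elim(2) w by (auto simp: Z_def)
  qed
qed

text \<open>
  The masses of both cascades on a cell factorise over the path to the cell, so the branching
  property evaluates their joint moments exactly.
\<close>

lemma nn_integral_cell_moment:
  assumes w: "w \<in> words l n"
  shows "(\<integral>\<^sup>+\<omega>. emeasure (m' \<omega>) (word_interval l w) * ennreal (Z w \<omega> powr s) \<partial>M) =
    ennreal (1 / real l ^ n) * ((\<integral>\<^sup>+p. ennreal (snd p * fst p powr s) \<partial>D) ^ n *
      (\<integral>\<^sup>+\<omega>. ennreal (C'.Y [] \<omega> * C.Y [] \<omega> powr s) \<partial>M))"
proof -
  let ?g = "\<lambda>p::real \<times> real. ennreal (snd p * fst p powr s)"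
  let ?G = "\<lambda>f. ennreal (enn2real (limit_mass l (\<lambda>v. snd (f v))) *
    enn2real (limit_mass l (\<lambda>v. fst (f v))) powr s)"
  have fs: "fst \<in> borel_measurable (borel :: (real \<times> real) measure)"
    "snd \<in> borel_measurable (borel :: (real \<times> real) measure)"
    by (auto intro!: borel_measurable_continuous_onI continuous_intros)
  note [measurable] = limit_mass_measurable[OF fs(1)] limit_mass_measurable[OF fs(2)] fs
  have g: "?g \<in> borel_measurable borel"
    by measurable
  have G: "?G \<in> borel_measurable pair.trees"
    by measurable
  have G_subtree: "?G (pair.subtree w \<omega>) = ennreal (C'.Y w \<omega> * C.Y w \<omega> powr s)" for w \<omega>
  proof -
    have "limit_mass l (\<lambda>v. snd (pair.subtree w \<omega> v)) = limit_mass l (\<lambda>v. V' (w @ v) \<omega>)"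
      "limit_mass l (\<lambda>v. fst (pair.subtree w \<omega> v)) = limit_mass l (\<lambda>v. V (w @ v) \<omega>)"
      by (intro limit_mass_cong; simp add: pair.subtree_def)+
    then show ?thesis
      by (simp add: C.Y_def C'.Y_def)
  qed
  have meas: "(\<lambda>\<omega>. (\<Prod>k=1..n. ?g (V (take k w) \<omega>, V' (take k w) \<omega>)) * ?G (pair.subtree w \<omega>)) \<in> borel_measurable M"
    using take_nonempty_word[OF w]
    by (intro borel_measurable_times_ennreal borel_measurable_prod_ennreal
        measurable_compose[OF pair.X_measurable g] measurable_compose[OF pair.subtree_measurable[OF w] G]) auto
  have "(\<integral>\<^sup>+\<omega>. emeasure (m' \<omega>) (word_interval l w) * ennreal (Z w \<omega> powr s) \<partial>M) =
    (\<integral>\<^sup>+\<omega>. ennreal (1 / real l ^ n) * ((\<Prod>k=1..n. ?g (V (take k w) \<omega>, V' (take k w) \<omega>)) * ?G (pair.subtree w \<omega>)) \<partial>M)"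
  proof (rule nn_integral_cong_AE, use AE_weights_pos C'.AE_emeasure_word_interval C'.AE_limit_mass_eq_Y in eventually_elim)
    fix \<omega>
    assume \<omega>: "\<forall>v\<in>nonempty_words l. 0 < V v \<omega> \<and> 0 \<le> V' v \<omega>"
      "\<forall>n. \<forall>w\<in>words l n. emeasure (m' \<omega>) (word_interval l w) =
        ennreal (path_weight (\<lambda>v. V' v \<omega>) w / real l ^ n) * limit_mass l (\<lambda>v. V' (w @ v) \<omega>)"
      "\<forall>n. \<forall>w\<in>words l n. limit_mass l (\<lambda>v. V' (w @ v) \<omega>) = ennreal (C'.Y w \<omega>)"
    have pos: "0 < V (take k w) \<omega>" "0 \<le> V' (take k w) \<omega>" if "k \<in> {1..n}" for k
      using \<omega>(1) take_nonempty_word[OF w that] by auto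
    have Q': "0 \<le> path_weight (\<lambda>v. V' v \<omega>) w" and Q: "0 \<le> path_weight (\<lambda>v. V v \<omega>) w"
      using \<omega>(1) by (auto intro!: path_weight_nonneg[OF _ w] intro: less_imp_le)
    have prod: "(\<Prod>k=1..n. ?g (V (take k w) \<omega>, V' (take k w) \<omega>)) =
        ennreal (path_weight (\<lambda>v. V' v \<omega>) w * path_weight (\<lambda>v. V v \<omega>) w powr s)"
    proof -
      have "path_weight (\<lambda>v. V v \<omega>) w powr s = (\<Prod>k=1..n. V (take k w) \<omega> powr s)"
        unfolding path_weight_def length_words[OF w]
        by (rule prod_powr_distrib)
      then show ?thesis
        using pos by (subst prod_ennreal) (auto simp: path_weight_def length_words[OF w] prod.distrib)
    qed
    show "emeasure (m' \<omega>) (word_interval l w) * ennreal (Z w \<omega> powr s) =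
        ennreal (1 / real l ^ n) * ((\<Prod>k=1..n. ?g (V (take k w) \<omega>, V' (take k w) \<omega>)) * ?G (pair.subtree w \<omega>))"
      unfolding prod G_subtree Z_def using \<omega>(2,3) w Q Q' C.Y_nonneg C'.Y_nonneg
      by (simp add: ennreal_mult[symmetric] powr_mult ac_simps)
  qed
  also have "\<dots> = ennreal (1 / real l ^ n) * (\<integral>\<^sup>+\<omega>. (\<Prod>k=1..n. ?g (V (take k w) \<omega>, V' (take k w) \<omega>)) * ?G (pair.subtree w \<omega>) \<partial>M)"
    by (rule nn_integral_cmult[OF meas])
  also have "\<dots> = ennreal (1 / real l ^ n) * ((\<integral>\<^sup>+p. ?g p \<partial>D) ^ n * (\<integral>\<^sup>+\<omega>. ?G (pair.subtree [] \<omega>) \<partial>M))"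
    by (subst pair.nn_integral_path_subtree[OF w g G]) simp
  finally show ?thesis
    unfolding G_subtree .
qed

text \<open>
  Chernoff's bound: the expected \<open>m'\<close>-mass of the cells of generation \<open>n\<close> with \<open>Z\<^sup>s \<ge> exp (n \<kappa>)\<close>
  decays geometrically as soon as \<open>E[W' W\<^sup>s] < exp \<kappa>\<close>, and the Borel--Cantelli lemma applies to
  almost every realisation of \<open>m'\<close>.
\<close>

lemma AE_AE_eventually_powr_less:
  assumes \<phi>: "(\<integral>\<^sup>+p. ennreal (snd p * fst p powr s) \<partial>D) < ennreal (exp \<kappa>)"
    and fin: "(\<integral>\<^sup>+\<omega>. ennreal (C'.Y [] \<omega> * C.Y [] \<omega> powr s) \<partial>M) < \<infinity>"
  shows "AE \<omega> in M. AE x in m' \<omega>. \<forall>\<^sub>F n in sequentially. \<forall>w\<in>words l n.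
    x \<in> word_interval l w \<longrightarrow> Z w \<omega> powr s < exp (real n * \<kappa>)"
proof -
  define \<phi> where "\<phi> = enn2real (\<integral>\<^sup>+p. ennreal (snd p * fst p powr s) \<partial>D)"
  define c where "c = enn2real (\<integral>\<^sup>+\<omega>. ennreal (C'.Y [] \<omega> * C.Y [] \<omega> powr s) \<partial>M)"
  have \<phi>_eq: "(\<integral>\<^sup>+p. ennreal (snd p * fst p powr s) \<partial>D) = ennreal \<phi>" "0 \<le> \<phi>" "\<phi> < exp \<kappa>"
  proof -
    have "(\<integral>\<^sup>+p. ennreal (snd p * fst p powr s) \<partial>D) < top"
      using \<phi> by (rule order_less_trans) simp
    then show 1: "(\<integral>\<^sup>+p. ennreal (snd p * fst p powr s) \<partial>D) = ennreal \<phi>"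
      by (simp add: \<phi>_def)
    show "0 \<le> \<phi>"
      by (simp add: \<phi>_def)
    then show "\<phi> < exp \<kappa>"
      using \<phi> unfolding 1 by (simp add: ennreal_less_iff)
  qed
  have c_eq: "(\<integral>\<^sup>+\<omega>. ennreal (C'.Y [] \<omega> * C.Y [] \<omega> powr s) \<partial>M) = ennreal c" "0 \<le> c"
    using fin by (auto simp: c_def)
  \<comment> \<open>The \<open>m'\<close>-mass of the cell of \<open>w\<close> if the cell is exceptional, and \<open>0\<close> otherwise.\<close>
  define a where "a n w \<omega> = indicator {\<omega> \<in> space M. exp (real n * \<kappa>) \<le> Z w \<omega> powr s} \<omega> * emeasure (m' \<omega>) (word_interval l w)"
    for n w \<omega>
  have m'_meas: "(\<lambda>\<omega>. emeasure (m' \<omega>) (word_interval l w)) \<in> borel_measurable M" if "w \<in> words l n" for n w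
    by (rule C'.m_measurable[OF C'.word_interval_sets01[OF that]])
  have a_meas: "a n w \<in> borel_measurable M" if "w \<in> words l n" for n w
    unfolding a_def using m'_meas[OF that] Z_measurable[OF that] by measurable
  have a_bound: "(\<integral>\<^sup>+\<omega>. a n w \<omega> \<partial>M) \<le> ennreal ((\<phi> / exp \<kappa>) ^ n * c / real l ^ n)" if w: "w \<in> words l n" for n w
  proof -
    have "(\<integral>\<^sup>+\<omega>. a n w \<omega> \<partial>M) \<le>
        (\<integral>\<^sup>+\<omega>. ennreal (exp (- (real n * \<kappa>))) * (emeasure (m' \<omega>) (word_interval l w) * ennreal (Z w \<omega> powr s)) \<partial>M)"
    proof (rule nn_integral_mono)
      fix \<omega>
      have "1 \<le> ennreal (exp (- (real n * \<kappa>))) * ennreal (Z w \<omega> powr s)" if "exp (real n * \<kappa>) \<le> Z w \<omega> powr s"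
        using that by (simp add: ennreal_mult'[symmetric] exp_minus field_simps)
      from mult_right_mono[OF this, of "emeasure (m' \<omega>) (word_interval l w)"]
      show "a n w \<omega> \<le> ennreal (exp (- (real n * \<kappa>))) * (emeasure (m' \<omega>) (word_interval l w) * ennreal (Z w \<omega> powr s))"
        by (auto simp: a_def indicator_def mult_ac)
    qed
    also have "\<dots> = ennreal (exp (- (real n * \<kappa>))) *
        (\<integral>\<^sup>+\<omega>. emeasure (m' \<omega>) (word_interval l w) * ennreal (Z w \<omega> powr s) \<partial>M)"
      using m'_meas[OF w] Z_measurable[OF w] by (intro nn_integral_cmult borel_measurable_times_ennreal) auto
    also have "\<dots> = ennreal (exp (- (real n * \<kappa>)) * (1 / real l ^ n * (\<phi> ^ n * c)))"
      using \<phi>_eq c_eq unfolding nn_integral_cell_moment[OF w] by (simp add: ennreal_power ennreal_mult'[symmetric])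
    also have "exp (- (real n * \<kappa>)) * (1 / real l ^ n * (\<phi> ^ n * c)) = (\<phi> / exp \<kappa>) ^ n * c / real l ^ n"
      by (simp add: exp_minus exp_of_nat_mult power_divide divide_simps)
    finally show ?thesis .
  qed
  have sum_bound: "(\<integral>\<^sup>+\<omega>. (\<Sum>w\<in>words l n. a n w \<omega>) \<partial>M) \<le> ennreal ((\<phi> / exp \<kappa>) ^ n * c)" for n
  proof -
    have "(\<integral>\<^sup>+\<omega>. (\<Sum>w\<in>words l n. a n w \<omega>) \<partial>M) = (\<Sum>w\<in>words l n. \<integral>\<^sup>+\<omega>. a n w \<omega> \<partial>M)"
      by (intro nn_integral_sum a_meas)
    also have "\<dots> \<le> (\<Sum>w\<in>words l n. ennreal ((\<phi> / exp \<kappa>) ^ n * c / real l ^ n))"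
      by (intro sum_mono a_bound)
    also have "\<dots> = ennreal ((\<phi> / exp \<kappa>) ^ n * c)"
      using \<phi>_eq c_eq pair.l_ge_2
      by (simp add: card_words ennreal_of_nat_eq_real_of_nat ennreal_mult'[symmetric] ennreal_power)
    finally show ?thesis .
  qed
  have "(\<integral>\<^sup>+\<omega>. (\<Sum>n. \<Sum>w\<in>words l n. a n w \<omega>) \<partial>M) = (\<Sum>n. \<integral>\<^sup>+\<omega>. (\<Sum>w\<in>words l n. a n w \<omega>) \<partial>M)"
    by (intro nn_integral_suminf borel_measurable_sum a_meas)
  also have "\<dots> \<le> (\<Sum>n. ennreal ((\<phi> / exp \<kappa>) ^ n * c))"
    by (intro suminf_le sum_bound) auto
  also have "\<dots> < top"
  proof -
    have "summable (\<lambda>n. (\<phi> / exp \<kappa>) ^ n * c)"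
      using \<phi>_eq by (intro summable_mult2 summable_geometric) simp
    then show ?thesis
      using \<phi>_eq c_eq by (subst less_top[symmetric]) (intro ennreal_suminf_neq_top; simp)
  qed
  finally have "(\<integral>\<^sup>+\<omega>. (\<Sum>n. \<Sum>w\<in>words l n. a n w \<omega>) \<partial>M) \<noteq> \<infinity>"
    by simp
  then have "AE \<omega> in M. (\<Sum>n. \<Sum>w\<in>words l n. a n w \<omega>) \<noteq> \<infinity>"
    by (intro nn_integral_noteq_infinite borel_measurable_suminf_order borel_measurable_sum a_meas)
  with AE_space show ?thesis
  proof eventually_elim
    case (elim \<omega>)
    interpret m': finite_measure "m' \<omega>" by (rule C'.finite_m[OF elim(1)])
    define B where "B n = {w \<in> words l n. exp (real n * \<kappa>) \<le> Z w \<omega> powr s}" for n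
    define A where "A n = (\<Union>w\<in>B n. word_interval l w)" for n
    have fin_B: "finite (B n)" for n
      by (simp add: B_def)
    have sets: "word_interval l w \<in> sets (m' \<omega>)" if "w \<in> words l n" for w n
      unfolding C'.sets_m[OF elim(1)] using that by (rule C'.word_interval_sets01)
    have A_sets: "A n \<in> sets (m' \<omega>)" for n
      unfolding A_def using fin_B by (intro sets.finite_UN sets) (auto simp: B_def)
    have "emeasure (m' \<omega>) (A n) \<le> (\<Sum>w\<in>B n. emeasure (m' \<omega>) (word_interval l w))" for n
      unfolding A_def using fin_B by (intro emeasure_subadditive_finite image_subsetI sets) (auto simp: B_def)
    also have "(\<Sum>w\<in>B n. emeasure (m' \<omega>) (word_interval l w)) = (\<Sum>w\<in>words l n. a n w \<omega>)" for n
      using elim(1) unfolding B_def a_def by (subst sum.inter_filter, simp, intro sum.cong refl) (simp add: indicator_def)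
    finally have "(\<Sum>n. emeasure (m' \<omega>) (A n)) \<le> (\<Sum>n. \<Sum>w\<in>words l n. a n w \<omega>)"
      by (intro suminf_le) auto
    then have "(\<Sum>n. emeasure (m' \<omega>) (A n)) \<noteq> top"
      using elim(2) by (simp add: neq_top_trans)
    then have "(\<Sum>n. ennreal (measure (m' \<omega>) (A n))) \<noteq> top"
      unfolding m'.emeasure_eq_measure .
    then have "summable (\<lambda>n. measure (m' \<omega>) (A n))"
      by (rule summable_suminf_not_top[OF measure_nonneg])
    then have "AE x in m' \<omega>. eventually (\<lambda>n. x \<in> space (m' \<omega>) - A n) sequentially"
      by (intro borel_cantelli_AE1 A_sets) (auto simp: m'.emeasure_eq_measure)
    then show ?case
    proof eventually_elim
      case (elim x)
      then show ?case
        by eventually_elim (auto simp: A_def B_def not_le)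
    qed
  qed
qed

text \<open>
  Small positive exponents bound \<open>ln Z\<close> from above and small negative ones from below. Countably many
  deviations \<open>1 / (k + 1)\<close> suffice, so the exceptional null sets can be collected.
\<close>

lemma AE_AE_log_density_tendsto:
  assumes upper: "\<And>\<delta>. \<delta> > 0 \<Longrightarrow> \<exists>s>0.
      (\<integral>\<^sup>+p. ennreal (snd p * fst p powr s) \<partial>D) < ennreal (exp (s * (\<mu> + \<delta>))) \<and>
      (\<integral>\<^sup>+\<omega>. ennreal (C'.Y [] \<omega> * C.Y [] \<omega> powr s) \<partial>M) < \<infinity>"
    and lower: "\<And>\<delta>. \<delta> > 0 \<Longrightarrow> \<exists>s>0.
      (\<integral>\<^sup>+p. ennreal (snd p * fst p powr (- s)) \<partial>D) < ennreal (exp (s * (- \<mu> + \<delta>))) \<and>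
      (\<integral>\<^sup>+\<omega>. ennreal (C'.Y [] \<omega> * C.Y [] \<omega> powr (- s)) \<partial>M) < \<infinity>"
  shows "AE \<omega> in M. AE x in m' \<omega>. \<forall>\<delta>>0. \<forall>\<^sub>F n in sequentially. \<forall>w\<in>words l n.
    x \<in> word_interval l w \<longrightarrow> \<bar>ln (Z w \<omega>) - real n * \<mu>\<bar> < real n * \<delta>"
proof -
  have "AE \<omega> in M. AE x in m' \<omega>. \<forall>\<^sub>F n in sequentially. \<forall>w\<in>words l n.
      x \<in> word_interval l w \<longrightarrow> \<bar>ln (Z w \<omega>) - real n * \<mu>\<bar> < real n * (1 / real (Suc k))" for k
  proof -
    let ?\<delta> = "1 / real (Suc k)"
    have \<delta>: "?\<delta> > 0"
      by simp
    obtain s where s: "s > 0" "(\<integral>\<^sup>+p. ennreal (snd p * fst p powr s) \<partial>D) < ennreal (exp (s * (\<mu> + ?\<delta>)))"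
      "(\<integral>\<^sup>+\<omega>. ennreal (C'.Y [] \<omega> * C.Y [] \<omega> powr s) \<partial>M) < \<infinity>"
      using upper[OF \<delta>] by blast
    obtain t where t: "t > 0" "(\<integral>\<^sup>+p. ennreal (snd p * fst p powr (- t)) \<partial>D) < ennreal (exp (t * (- \<mu> + ?\<delta>)))"
      "(\<integral>\<^sup>+\<omega>. ennreal (C'.Y [] \<omega> * C.Y [] \<omega> powr (- t)) \<partial>M) < \<infinity>"
      using lower[OF \<delta>] by blast
    show ?thesis
      using AE_AE_eventually_powr_less[OF s(2,3)] AE_AE_eventually_powr_less[OF t(2,3)] AE_Z_pos
    proof eventually_elim
      case (elim \<omega>)
      note Zpos = elim(3)
      show ?case
        using elim(1,2)
      proof eventually_elim
        case (elim x)
        then show ?case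
        proof eventually_elim
          case (elim n)
          show ?case
          proof (intro ballI impI)
            fix w assume w: "w \<in> words l n" "x \<in> word_interval l w"
            have pos: "0 < Z w \<omega>"
              using Zpos w by blast
            have "exp (s * ln (Z w \<omega>)) < exp (real n * (s * (\<mu> + ?\<delta>)))"
              using elim(1) w pos by (auto simp: powr_def)
            then have "s * ln (Z w \<omega>) < s * (real n * (\<mu> + ?\<delta>))"
              by (simp only: exp_less_cancel_iff mult.left_commute)
            then have up: "ln (Z w \<omega>) < real n * (\<mu> + ?\<delta>)"
              using s(1) by (simp only: mult_less_cancel_left_pos)
            have "exp (- t * ln (Z w \<omega>)) < exp (real n * (t * (- \<mu> + ?\<delta>)))"
              using elim(2) w pos by (auto simp: powr_def)
            then have "t * - ln (Z w \<omega>) < t * (real n * (- \<mu> + ?\<delta>))"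
              by (simp only: exp_less_cancel_iff mult.left_commute mult_minus_left mult_minus_right)
            then have "- ln (Z w \<omega>) < real n * (- \<mu> + ?\<delta>)"
              using t(1) by (simp only: mult_less_cancel_left_pos)
            with up show "\<bar>ln (Z w \<omega>) - real n * \<mu>\<bar> < real n * ?\<delta>"
              by (simp only: abs_less_iff distrib_left mult_minus_right) linarith
          qed
        qed
      qed
    qed
  qed
  then have "AE \<omega> in M. \<forall>k. AE x in m' \<omega>. \<forall>\<^sub>F n in sequentially. \<forall>w\<in>words l n.
      x \<in> word_interval l w \<longrightarrow> \<bar>ln (Z w \<omega>) - real n * \<mu>\<bar> < real n * (1 / real (Suc k))"
    unfolding AE_all_countable by blast
  then show ?thesis
  proof eventually_elim
    case (elim \<omega>)
    then have "AE x in m' \<omega>. \<forall>k. \<forall>\<^sub>F n in sequentially. \<forall>w\<in>words l n.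
      x \<in> word_interval l w \<longrightarrow> \<bar>ln (Z w \<omega>) - real n * \<mu>\<bar> < real n * (1 / real (Suc k))"
      unfolding AE_all_countable .
    then show ?case
    proof eventually_elim
      case (elim x)
      show ?case
      proof (intro allI impI)
        fix \<delta> :: real assume "\<delta> > 0"
        then obtain k where k: "1 / real (Suc k) < \<delta>"
          using reals_Archimedean[of \<delta>] by (auto simp: inverse_eq_divide)
        have "real n * (1 / real (Suc k)) \<le> real n * \<delta>" for n
          using k by (intro mult_left_mono) auto
        then show "\<forall>\<^sub>F n in sequentially. \<forall>w\<in>words l n.
            x \<in> word_interval l w \<longrightarrow> \<bar>ln (Z w \<omega>) - real n * \<mu>\<bar> < real n * \<delta>"
          using elim[rule_format, of k] by (elim eventually_mono) (blast intro: order_less_le_trans)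
      qed
    qed
  qed
qed

end

section \<open>The local dimension\<close>

theorem theorem6:
  fixes l :: nat
    and N :: "'b measure" and W W' :: "'b \<Rightarrow> real"
    and M :: "'a measure" and V V' :: "nat list \<Rightarrow> 'a \<Rightarrow> real"
    and m m' :: "'a \<Rightarrow> real measure"
  assumes l: "l \<ge> 2"
    and N: "prob_space N"
    and W: "W \<in> borel_measurable N" "AE \<omega> in N. 0 \<le> W \<omega>" "prob_space.expectation N W = 1"
    and W': "W' \<in> borel_measurable N" "AE \<omega> in N. 0 \<le> W' \<omega>" "prob_space.expectation N W' = 1"
    and M: "prob_space M"
    and copies: "independent_copies M (nonempty_words l) (\<lambda>w \<omega>. (V w \<omega>, V' w \<omega>)) N (\<lambda>\<omega>. (W \<omega>, W' \<omega>))"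
    and m: "mandelbrot_cascade l M V m" "nondegenerate M m"
    and m': "mandelbrot_cascade l M V' m'" "nondegenerate M m'"
    and moments: "\<exists>r>1. (\<integral>\<^sup>+\<omega>. ennreal (total_mass m \<omega> powr r) \<partial>M) < \<infinity> \<and>
                        (\<integral>\<^sup>+\<omega>. ennreal (total_mass m' \<omega> powr r) \<partial>M) < \<infinity>"
    and neg_moment: "\<exists>\<alpha>>0. (\<integral>\<^sup>+\<omega>. inverse (ennreal (total_mass m \<omega> powr \<alpha>)) \<partial>M) < \<infinity>"
  shows "integrable N (\<lambda>\<omega>. W' \<omega> * log (real l) (W \<omega>)) \<and>
    (AE \<omega> in M. AE x in m' \<omega>.
       x < 1 \<and>
       (\<forall>\<^sub>F n in sequentially. measure (m \<omega>) (cell l n x) > 0) \<and>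
       (\<lambda>n. ln (measure (m \<omega>) (cell l n x)) / ln (measure lborel (cell l n x)))
         \<longlonglongrightarrow> 1 - prob_space.expectation N (\<lambda>\<omega>. W' \<omega> * log (real l) (W \<omega>)))"
proof -
  interpret M: prob_space M by (rule M)
  interpret N: prob_space N by (rule N)
  obtain r where r: "r > 1" and mom: "(\<integral>\<^sup>+\<omega>. ennreal (total_mass m \<omega> powr r) \<partial>M) < \<infinity>"
    and mom': "(\<integral>\<^sup>+\<omega>. ennreal (total_mass m' \<omega> powr r) \<partial>M) < \<infinity>"
    using moments by blast
  obtain \<alpha> where \<alpha>: "\<alpha> > 0" and neg: "(\<integral>\<^sup>+\<omega>. inverse (ennreal (total_mass m \<omega> powr \<alpha>)) \<partial>M) < \<infinity>"
    using neg_moment by blast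
  have fs [measurable]: "fst \<in> borel_measurable (borel :: (real \<times> real) measure)"
    "snd \<in> borel_measurable (borel :: (real \<times> real) measure)"
    by (auto intro!: borel_measurable_continuous_onI continuous_intros)
  have WW' [measurable]: "(\<lambda>\<omega>. (W \<omega>, W' \<omega>)) \<in> borel_measurable N"
    using W(1) W'(1) by (rule borel_measurable_Pair)
  note [measurable] = W(1) W'(1)
  define D where "D = distr N borel (\<lambda>\<omega>. (W \<omega>, W' \<omega>))"
  have ind: "M.indep_vars (\<lambda>_. borel) (\<lambda>w \<omega>. (V w \<omega>, V' w \<omega>)) (nonempty_words l)"
    and law: "\<And>w. w \<in> nonempty_words l \<Longrightarrow> distr M borel (\<lambda>\<omega>. (V w \<omega>, V' w \<omega>)) = D"
    using copies unfolding independent_copies_def D_def by auto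
  have pair_meas: "(\<lambda>\<omega>. (V w \<omega>, V' w \<omega>)) \<in> borel_measurable M" if "w \<in> nonempty_words l" for w
    using ind that by (auto simp: M.indep_vars_def)
  have law1: "distr M borel (V w) = distr N borel W" and law2: "distr M borel (V' w) = distr N borel W'"
    if "w \<in> nonempty_words l" for w
  proof -
    have "distr M borel (V w) = distr (distr M borel (\<lambda>\<omega>. (V w \<omega>, V' w \<omega>))) borel fst"
      "distr M borel (V' w) = distr (distr M borel (\<lambda>\<omega>. (V w \<omega>, V' w \<omega>))) borel snd"
      using pair_meas[OF that] by (simp_all add: distr_distr comp_def)
    then show "distr M borel (V w) = distr N borel W" "distr M borel (V' w) = distr N borel W'"
      using law[OF that] by (simp_all add: D_def distr_distr comp_def)
  qed
  have ind1: "M.indep_vars (\<lambda>_. borel) V (nonempty_words l)"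
    and ind2: "M.indep_vars (\<lambda>_. borel) V' (nonempty_words l)"
    using M.indep_vars_compose2[OF ind, of "\<lambda>_. fst" "\<lambda>_. borel"]
      M.indep_vars_compose2[OF ind, of "\<lambda>_. snd" "\<lambda>_. borel"] by simp_all
  have integrable: "integrable N W" "integrable N W'"
    using W(3) W'(3) not_integrable_integral_eq by fastforce+
  interpret C: cascade M l V "distr N borel W" m
    by unfold_locales
      (use l ind1 law1 m(1) W integrable in \<open>auto simp: AE_distr_iff nn_integral_distr nn_integral_eq_integral\<close>)
  interpret C': cascade M l V' "distr N borel W'" m'
    by unfold_locales
      (use l ind2 law2 m'(1) W' integrable in \<open>auto simp: AE_distr_iff nn_integral_distr nn_integral_eq_integral\<close>)

  have W_mom: "(\<integral>\<^sup>+\<omega>. ennreal (W \<omega> powr r) \<partial>N) < \<infinity>"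
    using C.weight_moment_finite[OF m(2) _ mom] r by (simp add: nn_integral_distr)
  have W'_mom: "(\<integral>\<^sup>+\<omega>. ennreal (W' \<omega> powr r) \<partial>N) < \<infinity>"
    using C'.weight_moment_finite[OF m'(2) _ mom'] r by (simp add: nn_integral_distr)
  \<comment> \<open>The small-ball exponent of the weight is \<open>\<alpha> / l\<close>, and passing to a moment costs a factor \<open>2\<close>.\<close>
  define \<beta> where "\<beta> = \<alpha> / real l / 2"
  have \<beta>: "\<beta> > 0" "2 * \<beta> = \<alpha> / real l"
    using \<alpha> l by (simp_all add: \<beta>_def)
  obtain K where "\<And>u. u > 0 \<Longrightarrow> measure (distr N borel W) {..u} \<le> K * u powr (\<alpha> / real l)"
    using C.weight_small_ball[OF \<alpha> neg] by blast
  then have "\<And>u. u > 0 \<Longrightarrow> measure (distr N borel W) {..u} \<le> K * u powr (2 * \<beta>)"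
    unfolding \<beta>(2) .
  note small = negative_moment_of_small_ball[OF C.prob_space_D C.sets_D \<beta>(1) this]
  have W_pos: "AE \<omega> in N. 0 < W \<omega>"
    using small(1) by (simp add: AE_distr_iff)
  have W_neg: "(\<integral>\<^sup>+\<omega>. ennreal (W \<omega> powr (- \<beta>)) \<partial>N) < \<infinity>"
    using small(2) by (simp add: nn_integral_distr)
  have D_pos: "AE p in D. 0 < fst p \<and> 0 \<le> snd p"
    using W_pos W'(2) unfolding D_def by (subst AE_distr_iff) auto
  note Y_pos = C.AE_Y_pos[OF \<alpha> neg]
  have "branching_weights M l (\<lambda>w \<omega>. (V w \<omega>, V' w \<omega>)) D"
    by (intro branching_weights.intro branching_weights_axioms.intro M l ind law)
  then interpret cascade_pair M l V V' D "distr N borel W" m "distr N borel W'" m'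
    by (intro cascade_pair.intro cascade_pair_axioms.intro C.cascade_axioms C'.cascade_axioms D_pos Y_pos)

  obtain s0 where s0: "s0 > 0"
    and W_fin: "\<And>s. \<bar>s\<bar> \<le> s0 \<Longrightarrow> (\<integral>\<^sup>+\<omega>. ennreal (W' \<omega> * W \<omega> powr s) \<partial>N) < \<infinity>"
    using N.product_moments_finite[OF W'(1) W(1) W'(2) W_pos r \<beta>(1) W'_mom W_mom W_neg] by blast
  obtain t0 where t0: "t0 > 0"
    and Y_fin: "\<And>s. \<bar>s\<bar> \<le> t0 \<Longrightarrow> (\<integral>\<^sup>+\<omega>. ennreal (C'.Y [] \<omega> * C.Y [] \<omega> powr s) \<partial>M) < \<infinity>"
  proof (rule M.product_moments_finite[of "C'.Y []" "C.Y []" r \<alpha>])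
    show "C'.Y [] \<in> borel_measurable M" "C.Y [] \<in> borel_measurable M"
      by (auto intro: C.Y_measurable[of _ 0] C'.Y_measurable[of _ 0])
    show "AE \<omega> in M. 0 < C.Y [] \<omega>"
      using Y_pos by eventually_elim (auto dest: spec[of _ 0])
    show "(\<integral>\<^sup>+\<omega>. ennreal (C'.Y [] \<omega> powr r) \<partial>M) < \<infinity>"
      using mom' C'.nn_integral_Y[of "\<lambda>x. ennreal (x powr r)"] by simp
    show "(\<integral>\<^sup>+\<omega>. ennreal (C.Y [] \<omega> powr r) \<partial>M) < \<infinity>"
      using mom C.nn_integral_Y[of "\<lambda>x. ennreal (x powr r)"] by simp
  qed (use r \<alpha> C'.Y_nonneg C.nn_integral_Y_negative_moment[OF \<alpha> neg] in auto)
  define s1 where "s1 = min s0 t0"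
  have s1: "s1 > 0" "s1 \<le> s0" "s1 \<le> t0"
    using s0 t0 by (auto simp: s1_def)
  have exp_eq: "(\<integral>\<^sup>+\<omega>. ennreal (W' \<omega> * exp (s * ln (W \<omega>))) \<partial>N) = (\<integral>\<^sup>+\<omega>. ennreal (W' \<omega> * W \<omega> powr s) \<partial>N)" for s
    by (rule nn_integral_cong_AE, use W_pos in eventually_elim) (auto simp: powr_def)
  have exp_eq': "(\<integral>\<^sup>+\<omega>. ennreal (W' \<omega> * exp (s * - ln (W \<omega>))) \<partial>N) = (\<integral>\<^sup>+\<omega>. ennreal (W' \<omega> * W \<omega> powr (- s)) \<partial>N)" for s
    by (rule nn_integral_cong_AE, use W_pos in eventually_elim) (auto simp: powr_def)
  have D_eq: "(\<integral>\<^sup>+p. ennreal (snd p * fst p powr s) \<partial>D) = (\<integral>\<^sup>+\<omega>. ennreal (W' \<omega> * W \<omega> powr s) \<partial>N)" for s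
    unfolding D_def by (subst nn_integral_distr) auto
  have W'1: "(\<integral>\<^sup>+\<omega>. ennreal (W' \<omega>) \<partial>N) = 1"
    using W' integrable by (simp add: nn_integral_eq_integral)
  define \<mu> where "\<mu> = N.expectation (\<lambda>\<omega>. W' \<omega> * ln (W \<omega>))"
  have ln_W: "(\<lambda>\<omega>. ln (W \<omega>)) \<in> borel_measurable N" "(\<lambda>\<omega>. - ln (W \<omega>)) \<in> borel_measurable N"
    by measurable
  have fin1: "(\<integral>\<^sup>+\<omega>. ennreal (W' \<omega> * exp (s * ln (W \<omega>))) \<partial>N) < \<infinity>"
    and fin2: "(\<integral>\<^sup>+\<omega>. ennreal (W' \<omega> * exp (s * - ln (W \<omega>))) \<partial>N) < \<infinity>" if "\<bar>s\<bar> \<le> s1" for s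
    unfolding exp_eq exp_eq' using W_fin that s1 by auto
  \<comment> \<open>The lower deviations are the upper deviations of \<open>- ln W\<close>.\<close>
  note up = N.exponential_moment_bound[OF W'(1) ln_W(1) W'(2) W'1 s1(1) fin1]
  note low = N.exponential_moment_bound(2)[OF W'(1) ln_W(2) W'(2) W'1 s1(1) fin2]
  have log_eq: "W' \<omega> * log (real l) (W \<omega>) = W' \<omega> * ln (W \<omega>) / ln (real l)" for \<omega>
    by (simp add: log_def)
  have int_log: "integrable N (\<lambda>\<omega>. W' \<omega> * log (real l) (W \<omega>))"
    and exp_log: "N.expectation (\<lambda>\<omega>. W' \<omega> * log (real l) (W \<omega>)) = \<mu> / ln (real l)"
    unfolding log_eq \<mu>_def using up(1) by auto
  have dens: "AE \<omega> in M. AE x in m' \<omega>. \<forall>\<delta>>0. \<forall>\<^sub>F n in sequentially. \<forall>w\<in>words l n.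
    x \<in> word_interval l w \<longrightarrow> \<bar>ln (Z w \<omega>) - real n * \<mu>\<bar> < real n * \<delta>"
  proof (rule AE_AE_log_density_tendsto)
    fix \<delta> :: real assume \<delta>: "\<delta> > 0"
    show "\<exists>s>0. (\<integral>\<^sup>+p. ennreal (snd p * fst p powr s) \<partial>D) < ennreal (exp (s * (\<mu> + \<delta>))) \<and>
      (\<integral>\<^sup>+\<omega>. ennreal (C'.Y [] \<omega> * C.Y [] \<omega> powr s) \<partial>M) < \<infinity>"
      using up(2)[OF _ \<delta>] Y_fin s1 unfolding D_eq exp_eq \<mu>_def by fastforce
    show "\<exists>s>0. (\<integral>\<^sup>+p. ennreal (snd p * fst p powr (- s)) \<partial>D) < ennreal (exp (s * (- \<mu> + \<delta>))) \<and>
      (\<integral>\<^sup>+\<omega>. ennreal (C'.Y [] \<omega> * C.Y [] \<omega> powr (- s)) \<partial>M) < \<infinity>"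
      using low[OF _ \<delta>] Y_fin s1 unfolding D_eq exp_eq' \<mu>_def by fastforce
  qed
  have "AE \<omega> in M. AE x in m' \<omega>. x < 1 \<and>
       (\<forall>\<^sub>F n in sequentially. measure (m \<omega>) (cell l n x) > 0) \<and>
       (\<lambda>n. ln (measure (m \<omega>) (cell l n x)) / ln (measure lborel (cell l n x))) \<longlonglongrightarrow> 1 - \<mu> / ln (real l)"
    using dens AE_Z_pos C.AE_measure_word_interval C'.AE_no_mass_at_1 AE_space
  proof eventually_elim
    case (elim \<omega>)
    have sets': "sets (m' \<omega>) = sets (restrict_space borel {0..1})"
      by (rule C'.sets_m[OF elim(5)])
    then have space': "space (m' \<omega>) = {0..1}"
      by (auto dest: sets_eq_imp_space_eq simp: space_restrict_space)
    have "{1} \<in> null_sets (m' \<omega>)"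
      using elim(4) by (auto simp: null_sets_def sets' sets_restrict_space image_iff intro!: bexI[of _ "{1}"])
    then have "AE x in m' \<omega>. x \<notin> {1}"
      by (rule AE_not_in)
    with elim(1) AE_space show ?case
    proof eventually_elim
      case (elim x)
      note Zpos = \<open>\<forall>n. \<forall>w\<in>words l n. 0 < Z w \<omega>\<close>
      note mass = \<open>\<forall>n. \<forall>w\<in>words l n. measure (m \<omega>) (word_interval l w) =
        path_weight (\<lambda>v. V v \<omega>) w * C.Y w \<omega> / real l ^ n\<close>
      have x: "0 \<le> x" "x < 1"
        using elim(2,3) space' by auto
      have l1: "l \<ge> 1" and lnl: "ln (real l) > 0"
        using l by auto
      have "\<exists>w. w \<in> words l n \<and> x \<in> word_interval l w" for n
        using ex1_word_interval[OF l1 x] by blast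
      then obtain w where w: "\<And>n. w n \<in> words l n" "\<And>n. x \<in> word_interval l (w n)"
        by metis
      define z where "z n = Z (w n) \<omega>" for n
      have z: "0 < z n" for n
        using Zpos w by (auto simp: z_def)
      have cell: "cell l n x = word_interval l (w n)" for n
        by (rule cell_eq[OF l1 w])
      have m_cell: "measure (m \<omega>) (cell l n x) = z n / real l ^ n" for n
        using mass w(1)[of n] by (simp add: cell z_def Z_def)
      have leb: "measure lborel (cell l n x) = 1 / real l ^ n" for n
        by (simp add: cell measure_word_interval length_words[OF w(1)])
      \<comment> \<open>The deviation bound is applied along the words \<open>w n\<close> whose cells contain \<open>x\<close>.\<close>
      have "(\<lambda>n. ln (z n) / real n) \<longlonglongrightarrow> \<mu>"
      proof (rule tendstoI)
        fix e :: real assume "e > 0"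
        with elim(1) have "\<forall>\<^sub>F n in sequentially. \<forall>w\<in>words l n.
            x \<in> word_interval l w \<longrightarrow> \<bar>ln (Z w \<omega>) - real n * \<mu>\<bar> < real n * e"
          by blast
        with eventually_gt_at_top[of 0]
        show "\<forall>\<^sub>F n in sequentially. dist (ln (z n) / real n) \<mu> < e"
        proof eventually_elim
          case (elim n)
          then have "\<bar>ln (z n) - real n * \<mu>\<bar> < real n * e"
            using w by (auto simp: z_def)
          moreover have "ln (z n) / real n - \<mu> = (ln (z n) - real n * \<mu>) / real n"
            using elim(1) by (simp add: diff_divide_distrib)
          ultimately show ?case
            using elim(1) by (simp add: dist_real_def divide_less_eq mult.commute)
        qed
      qed
      then have lim: "(\<lambda>n. 1 - (ln (z n) / real n) / ln (real l)) \<longlonglongrightarrow> 1 - \<mu> / ln (real l)"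
        using lnl by (intro tendsto_intros) auto
      have "\<forall>\<^sub>F n in sequentially. 1 - (ln (z n) / real n) / ln (real l) =
          ln (measure (m \<omega>) (cell l n x)) / ln (measure lborel (cell l n x))"
        using eventually_gt_at_top[of 0]
      proof eventually_elim
        case (elim n)
        have 1: "ln (measure (m \<omega>) (cell l n x)) = ln (z n) - real n * ln (real l)"
          using z[of n] l1 by (simp add: m_cell ln_div ln_realpow)
        have 2: "ln (measure lborel (cell l n x)) = - (real n * ln (real l))"
          using l1 by (simp add: leb ln_div ln_realpow)
        show ?case
          unfolding 1 2 using elim lnl by (simp add: field_simps)
      qed
      from Lim_transform_eventually[OF lim this] show ?case
        using x z l1 by (auto simp: m_cell)
    qed
  qed
  then show ?thesis
    unfolding exp_log using int_log by blast
qed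

end
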